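(* Let $\mathbf{P}$ be a small additive category. The essential image of the functor $\overline{M}: \mathcal{Q}(\mathbf{P}) \rightarrow \mathrm{Mod}\text{-}\mathbf{P}$ is the smallest full and replete additive subcategory $\mathbf{F} \subseteq \mathrm{Mod}\text{-}\mathbf{P}$ with the following properties: (1) $\mathbf{P} \subseteq \mathbf{F}$ via the Yoneda embedding, i.e. $\mathrm{Hom}_{\mathbf{P}}(-,A) \in \mathbf{F}$ for all $A \in \mathbf{P}$; (2) $\mathbf{F}$ is closed under taking cokernels in $\mathrm{Mod}\text{-}\mathbf{P}$; (3) $\mathbf{F}$ is closed under taking images in $\mathrm{Mod}\text{-}\mathbf{P}$.
   Context: Composition is written diagrammatically: for $\alpha: A \to B$ and $\beta: B \to C$, the composite is $\alpha\cdot\beta: A \to C$. Functors between additive categories are additive. A cospan in $\mathbf{P}$ is a pair of morphisms $(A \xrightarrow{\gamma} B \xleftarrow{\rho} C)$ with common codomain. $\mathrm{Syz}(A \xrightarrow{\gamma} B \xleftarrow{\rho} C)$ is the full subcategory of the slice category of $\mathbf{P}$ over $A$ whose objects, called syzygies, are the morphisms $\sigma: S \to A$ for which there exists $\omega: S \to C$ (a syzygy witness) with $\sigma\cdot\gamma = \omega\cdot\rho$. The additive category $\mathrm{Aux}(\mathbf{P})$ has as objects the cospans $(A \xrightarrow{\gamma_A} \Omega_A \xleftarrow{\rho_A} R_A)$ in $\mathbf{P}$; a morphism from $(A \xrightarrow{\gamma_A} \Omega_A \xleftarrow{\rho_A} R_A)$ to $(B \xrightarrow{\gamma_B} \Omega_B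 \xleftarrow{\rho_B} R_B)$ is a morphism $\alpha: A \to B$ in $\mathbf{P}$ such that $\sigma \in \mathrm{Syz}(A \xrightarrow{\gamma_A} \Omega_A \xleftarrow{\rho_A} R_A)$ implies $\sigma\cdot\alpha \in \mathrm{Syz}(B \xrightarrow{\gamma_B} \Omega_B \xleftarrow{\rho_B} R_B)$; composition and identities are those of $\mathbf{P}$. The ideal $\mathbf{I}(\mathbf{P})$ of $\mathrm{Aux}(\mathbf{P})$ consists of the morphisms $\alpha$ (notation as before) for which there exists $\zeta: A \to R_B$ with $\alpha\cdot\gamma_B = \zeta\cdot\rho_B$. $\mathcal{Q}(\mathbf{P}) := \mathrm{Aux}(\mathbf{P})/\mathbf{I}(\mathbf{P})$ is the additive quotient category; the class of $\alpha$ is denoted $\overline{\alpha}$. $\mathrm{Mod}\text{-}\mathbf{P}$ is the category of additive functors $\mathbf{P}^{\mathrm{op}} \to \mathrm{Ab}$; write $(-,A) := \mathrm{Hom}_{\mathbf{P}}(-,A)$. The functor $\overline{M}$ sends $(A \xrightarrow{\gamma_A} \Omega_A \xleftarrow{\rho_A} R_A)$ to the functor $\frac{\mathrm{im}(-,\gamma_A)}{\mathrm{im}(-,\rho_A)\cap \mathrm{im}(-,\gamma_A)}$ (a subquotient of $(-,\Omega_A)$). With $\epsilon_A: (-,A) \to \frac{\mathrm{im}(-,\gamma_A)}{\mathrm{im}(-,\rho_A)\cap \mathrm{im}(-,\gamma_A)}$ the natural epimorphism (coastriction of $(-,\gamma_A)$ to its image followed by projection), $\overline{M}(\overline{\alpha})$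 is the unique morphism with $\epsilon_A \cdot \overline{M}(\overline{\alpha}) = (-,\alpha)\cdot \epsilon_B$. A subcategory $\mathbf{A}$ of $\mathbf{B}$ is replete if for any $X \in \mathbf{A}$ and any isomorphism $\iota: X \to Y$ in $\mathbf{B}$, $\iota$ belongs to $\mathbf{A}$. The essential image of $\overline{M}$ is the smallest full replete subcategory of $\mathrm{Mod}\text{-}\mathbf{P}$ containing all objects $\overline{M}(X)$, $X \in \mathcal{Q}(\mathbf{P})$. *)

theory Defs
  imports "HOL-Algebra.Coset"
begin

section \<open>Preadditive and additive categories\<close>

text \<open>
  Hom groups are HOL-Algebra groups, so addition of morphisms is written multiplicatively and the
  zero morphism is \<open>\<one>\<close>. Hom sets are not required to be disjoint; hence identities and composition
  are indexed by objects. Composition is diagrammatic: \<open>Cmp C X Y Z f g\<close> is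
  \<open>X \<rightarrow> Y \<rightarrow> Z\<close>, first \<open>f\<close>, then \<open>g\<close>.
\<close>

record ('o, 'm) addcat =
  Ob :: "'o set"
  HomG :: "'o \<Rightarrow> 'o \<Rightarrow> 'm monoid"
  Idt :: "'o \<Rightarrow> 'm"
  Cmp :: "'o \<Rightarrow> 'o \<Rightarrow> 'o \<Rightarrow> 'm \<Rightarrow> 'm \<Rightarrow> 'm"

abbreviation Hom :: "('o, 'm) addcat \<Rightarrow> 'o \<Rightarrow> 'o \<Rightarrow> 'm set" where
  "Hom C X Y \<equiv> carrier (HomG C X Y)"

abbreviation ZeroM :: "('o, 'm) addcat \<Rightarrow> 'o \<Rightarrow> 'o \<Rightarrow> 'm" where
  "ZeroM C X Y \<equiv> \<one>\<^bsub>HomG C X Y\<^esub>"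

locale preadditive_category =
  fixes C :: "('o, 'm) addcat"
  assumes hom_group: "\<lbrakk>X \<in> Ob C; Y \<in> Ob C\<rbrakk> \<Longrightarrow> comm_group (HomG C X Y)"
    and idt_closed: "X \<in> Ob C \<Longrightarrow> Idt C X \<in> Hom C X X"
    and cmp_closed: "\<lbrakk>X \<in> Ob C; Y \<in> Ob C; Z \<in> Ob C; f \<in> Hom C X Y; g \<in> Hom C Y Z\<rbrakk>
      \<Longrightarrow> Cmp C X Y Z f g \<in> Hom C X Z"
    and idt_left: "\<lbrakk>X \<in> Ob C; Y \<in> Ob C; f \<in> Hom C X Y\<rbrakk> \<Longrightarrow> Cmp C X X Y (Idt C X) f = f"
    and idt_right: "\<lbrakk>X \<in> Ob C; Y \<in> Ob C; f \<in> Hom C X Y\<rbrakk> \<Longrightarrow> Cmp C X Y Y f (Idt C Y) = f"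
    and cmp_assoc: "\<lbrakk>X \<in> Ob C; Y \<in> Ob C; Z \<in> Ob C; W \<in> Ob C;
        f \<in> Hom C X Y; g \<in> Hom C Y Z; h \<in> Hom C Z W\<rbrakk>
      \<Longrightarrow> Cmp C X Z W (Cmp C X Y Z f g) h = Cmp C X Y W f (Cmp C Y Z W g h)"
    and cmp_add_left: "\<lbrakk>X \<in> Ob C; Y \<in> Ob C; Z \<in> Ob C;
        f \<in> Hom C X Y; f' \<in> Hom C X Y; g \<in> Hom C Y Z\<rbrakk>
      \<Longrightarrow> Cmp C X Y Z (f \<otimes>\<^bsub>HomG C X Y\<^esub> f') g
        = Cmp C X Y Z f g \<otimes>\<^bsub>HomG C X Z\<^esub> Cmp C X Y Z f' g"
    and cmp_add_right: "\<lbrakk>X \<in> Ob C; Y \<in> Ob C; Z \<in> Ob C;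
        f \<in> Hom C X Y; g \<in> Hom C Y Z; g' \<in> Hom C Y Z\<rbrakk>
      \<Longrightarrow> Cmp C X Y Z f (g \<otimes>\<^bsub>HomG C Y Z\<^esub> g')
        = Cmp C X Y Z f g \<otimes>\<^bsub>HomG C X Z\<^esub> Cmp C X Y Z f g'"

definition is_zero_object :: "('o, 'm) addcat \<Rightarrow> 'o \<Rightarrow> bool" where
  "is_zero_object C Z \<longleftrightarrow> Z \<in> Ob C \<and>
    (\<forall>X \<in> Ob C. (\<exists>!f. f \<in> Hom C X Z) \<and> (\<exists>!f. f \<in> Hom C Z X))"

definition is_biproduct ::
  "('o, 'm) addcat \<Rightarrow> 'o \<Rightarrow> 'o \<Rightarrow> 'o \<Rightarrow> 'm \<Rightarrow> 'm \<Rightarrow> 'm \<Rightarrow> 'm \<Rightarrow> bool" where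
  "is_biproduct C X Y B i j p q \<longleftrightarrow> B \<in> Ob C \<and>
    i \<in> Hom C X B \<and> j \<in> Hom C Y B \<and> p \<in> Hom C B X \<and> q \<in> Hom C B Y \<and>
    Cmp C X B X i p = Idt C X \<and> Cmp C Y B Y j q = Idt C Y \<and>
    Cmp C X B Y i q = ZeroM C X Y \<and> Cmp C Y B X j p = ZeroM C Y X \<and>
    Cmp C B X B p i \<otimes>\<^bsub>HomG C B B\<^esub> Cmp C B Y B q j = Idt C B"

locale additive_category = preadditive_category +
  assumes has_zero_object: "\<exists>Z. is_zero_object C Z"
    and has_biproducts:
      "\<lbrakk>X \<in> Ob C; Y \<in> Ob C\<rbrakk> \<Longrightarrow> \<exists>B i j p q. is_biproduct C X Y B i j p q"

definition is_iso :: "('o, 'm) addcat \<Rightarrow> 'o \<Rightarrow> 'o \<Rightarrow> 'm \<Rightarrow> bool" where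
  "is_iso C X Y f \<longleftrightarrow> f \<in> Hom C X Y \<and>
    (\<exists>g \<in> Hom C Y X. Cmp C X Y X f g = Idt C X \<and> Cmp C Y X Y g f = Idt C Y)"

definition is_cokernel :: "('o, 'm) addcat \<Rightarrow> 'o \<Rightarrow> 'o \<Rightarrow> 'm \<Rightarrow> 'o \<Rightarrow> 'm \<Rightarrow> bool" where
  "is_cokernel C X Y f K q \<longleftrightarrow> K \<in> Ob C \<and> q \<in> Hom C Y K \<and>
    Cmp C X Y K f q = ZeroM C X K \<and>
    (\<forall>W \<in> Ob C. \<forall>t \<in> Hom C Y W. Cmp C X Y W f t = ZeroM C X W \<longrightarrow>
      (\<exists>!s. s \<in> Hom C K W \<and> Cmp C Y K W q s = t))"

definition is_kernel :: "('o, 'm) addcat \<Rightarrow> 'o \<Rightarrow> 'o \<Rightarrow> 'm \<Rightarrow> 'o \<Rightarrow> 'm \<Rightarrow> bool" where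
  "is_kernel C X Y f K k \<longleftrightarrow> K \<in> Ob C \<and> k \<in> Hom C K X \<and>
    Cmp C K X Y k f = ZeroM C K Y \<and>
    (\<forall>W \<in> Ob C. \<forall>t \<in> Hom C W X. Cmp C W X Y t f = ZeroM C W Y \<longrightarrow>
      (\<exists>!s. s \<in> Hom C W K \<and> Cmp C W K X s k = t))"

text \<open>The image of a morphism, as usual in an abelian category: the kernel of its cokernel.\<close>

definition is_image :: "('o, 'm) addcat \<Rightarrow> 'o \<Rightarrow> 'o \<Rightarrow> 'm \<Rightarrow> 'o \<Rightarrow> 'm \<Rightarrow> bool" where
  "is_image C X Y f I i \<longleftrightarrow>
    (\<exists>K q. is_cokernel C X Y f K q \<and> is_kernel C Y K q I i)"


section \<open>Subcategories\<close>

text \<open>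
  The family of hom sets of a subcategory is required to be empty outside its objects, so that
  subcategories with the same objects and morphisms are equal.
\<close>

record ('o, 'm) subcat =
  SOb :: "'o set"
  SHom :: "'o \<Rightarrow> 'o \<Rightarrow> 'm set"

definition is_subcategory :: "('o, 'm) addcat \<Rightarrow> ('o, 'm) subcat \<Rightarrow> bool" where
  "is_subcategory C S \<longleftrightarrow> SOb S \<subseteq> Ob C \<and>
    (\<forall>X Y. SHom S X Y \<noteq> {} \<longrightarrow> X \<in> SOb S \<and> Y \<in> SOb S) \<and>
    (\<forall>X \<in> SOb S. \<forall>Y \<in> SOb S. SHom S X Y \<subseteq> Hom C X Y) \<and>
    (\<forall>X \<in> SOb S. Idt C X \<in> SHom S X X) \<and>
    (\<forall>X Y Z. \<forall>f \<in> SHom S X Y. \<forall>g \<in> SHom S Y Z. Cmp C X Y Z f g \<in> SHom S X Z)"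

definition is_full_subcategory :: "('o, 'm) addcat \<Rightarrow> ('o, 'm) subcat \<Rightarrow> bool" where
  "is_full_subcategory C S \<longleftrightarrow> is_subcategory C S \<and>
    (\<forall>X \<in> SOb S. \<forall>Y \<in> SOb S. SHom S X Y = Hom C X Y)"

definition is_replete :: "('o, 'm) addcat \<Rightarrow> ('o, 'm) subcat \<Rightarrow> bool" where
  "is_replete C S \<longleftrightarrow>
    (\<forall>X \<in> SOb S. \<forall>Y \<in> Ob C. \<forall>f. is_iso C X Y f \<longrightarrow> Y \<in> SOb S \<and> f \<in> SHom S X Y)"

definition induced_category :: "('o, 'm) addcat \<Rightarrow> ('o, 'm) subcat \<Rightarrow> ('o, 'm) addcat" where
  "induced_category C S =
    \<lparr>Ob = SOb S, HomG = (\<lambda>X Y. (HomG C X Y)\<lparr>carrier := SHom S X Y\<rparr>), Idt = Idt C, Cmp = Cmp C\<rparr>"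

definition is_additive_subcategory :: "('o, 'm) addcat \<Rightarrow> ('o, 'm) subcat \<Rightarrow> bool" where
  "is_additive_subcategory C S \<longleftrightarrow> is_subcategory C S \<and>
    (\<forall>X \<in> SOb S. \<forall>Y \<in> SOb S. subgroup (SHom S X Y) (HomG C X Y)) \<and>
    additive_category (induced_category C S)"

definition closed_under_cokernels :: "('o, 'm) addcat \<Rightarrow> ('o, 'm) subcat \<Rightarrow> bool" where
  "closed_under_cokernels C S \<longleftrightarrow>
    (\<forall>X \<in> SOb S. \<forall>Y \<in> SOb S. \<forall>f \<in> SHom S X Y. \<forall>K q.
      is_cokernel C X Y f K q \<longrightarrow> K \<in> SOb S \<and> q \<in> SHom S Y K)"

definition closed_under_images :: "('o, 'm) addcat \<Rightarrow> ('o, 'm) subcat \<Rightarrow> bool" where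
  "closed_under_images C S \<longleftrightarrow>
    (\<forall>X \<in> SOb S. \<forall>Y \<in> SOb S. \<forall>f \<in> SHom S X Y. \<forall>I i.
      is_image C X Y f I i \<longrightarrow> I \<in> SOb S \<and> i \<in> SHom S I Y)"

definition subcat_le :: "('o, 'm) subcat \<Rightarrow> ('o, 'm) subcat \<Rightarrow> bool" where
  "subcat_le S T \<longleftrightarrow> SOb S \<subseteq> SOb T \<and> (\<forall>X Y. SHom S X Y \<subseteq> SHom T X Y)"

definition is_smallest_subcat ::
  "(('o, 'm) subcat \<Rightarrow> bool) \<Rightarrow> ('o, 'm) subcat \<Rightarrow> bool" where
  "is_smallest_subcat \<Phi> S \<longleftrightarrow> \<Phi> S \<and> (\<forall>T. \<Phi> T \<longrightarrow> subcat_le S T)"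


section \<open>Additive functors and functor categories\<close>

record ('o, 'm, 'p, 'n) fnctr =
  FOb :: "'o \<Rightarrow> 'p"
  FMor :: "'o \<Rightarrow> 'o \<Rightarrow> 'm \<Rightarrow> 'n"

definition additive_functor ::
  "('o, 'm) addcat \<Rightarrow> ('p, 'n) addcat \<Rightarrow> ('o, 'm, 'p, 'n) fnctr \<Rightarrow> bool" where
  "additive_functor C D F \<longleftrightarrow>
    (\<forall>X \<in> Ob C. FOb F X \<in> Ob D) \<and>
    (\<forall>X \<in> Ob C. \<forall>Y \<in> Ob C. FMor F X Y \<in> hom (HomG C X Y) (HomG D (FOb F X) (FOb F Y))) \<and>
    (\<forall>X \<in> Ob C. FMor F X X (Idt C X) = Idt D (FOb F X)) \<and>
    (\<forall>X \<in> Ob C. \<forall>Y \<in> Ob C. \<forall>Z \<in> Ob C. \<forall>f \<in> Hom C X Y. \<forall>g \<in> Hom C Y Z.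
      FMor F X Z (Cmp C X Y Z f g)
        = Cmp D (FOb F X) (FOb F Y) (FOb F Z) (FMor F X Y f) (FMor F Y Z g))"

definition essential_image ::
  "('o, 'm) addcat \<Rightarrow> ('p, 'n) addcat \<Rightarrow> ('o, 'm, 'p, 'n) fnctr \<Rightarrow> ('p, 'n) subcat" where
  "essential_image C D F =
    (THE E. is_smallest_subcat
      (\<lambda>S. is_full_subcategory D S \<and> is_replete D S \<and> (\<forall>X \<in> Ob C. FOb F X \<in> SOb S)) E)"

definition op_category :: "('o, 'm) addcat \<Rightarrow> ('o, 'm) addcat" where
  "op_category C =
    \<lparr>Ob = Ob C, HomG = (\<lambda>X Y. HomG C Y X), Idt = Idt C, Cmp = (\<lambda>X Y Z f g. Cmp C Z Y X g f)\<rparr>"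

text \<open>Natural transformations are made \<open>undefined\<close> outside the objects of the source category.\<close>

definition nat_trans ::
  "('o, 'm) addcat \<Rightarrow> ('p, 'n) addcat \<Rightarrow> ('o, 'm, 'p, 'n) fnctr \<Rightarrow> ('o, 'm, 'p, 'n) fnctr
    \<Rightarrow> ('o \<Rightarrow> 'n) set" where
  "nat_trans C D F G = {\<eta> \<in> (\<Pi>\<^sub>E X \<in> Ob C. Hom D (FOb F X) (FOb G X)).
    \<forall>X \<in> Ob C. \<forall>Y \<in> Ob C. \<forall>f \<in> Hom C X Y.
      Cmp D (FOb F X) (FOb F Y) (FOb G Y) (FMor F X Y f) (\<eta> Y)
        = Cmp D (FOb F X) (FOb G X) (FOb G Y) (\<eta> X) (FMor G X Y f)}"

definition functor_category ::
  "('o, 'm) addcat \<Rightarrow> ('p, 'n) addcat \<Rightarrow> (('o, 'm, 'p, 'n) fnctr, 'o \<Rightarrow> 'n) addcat" where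
  "functor_category C D =
    \<lparr>Ob = {F. additive_functor C D F},
     HomG = (\<lambda>F G. \<lparr>carrier = nat_trans C D F G,
        mult = (\<lambda>\<eta> \<theta>. \<lambda>X \<in> Ob C. \<eta> X \<otimes>\<^bsub>HomG D (FOb F X) (FOb G X)\<^esub> \<theta> X),
        one = (\<lambda>X \<in> Ob C. ZeroM D (FOb F X) (FOb G X))\<rparr>),
     Idt = (\<lambda>F. \<lambda>X \<in> Ob C. Idt D (FOb F X)),
     Cmp = (\<lambda>F G H \<eta> \<theta>. \<lambda>X \<in> Ob C. Cmp D (FOb F X) (FOb G X) (FOb H X) (\<eta> X) (\<theta> X))\<rparr>"

text \<open>
  The category of abelian groups with elements in the universe \<open>'u\<close>. Homomorphisms are made
  \<open>undefined\<close> outside the carrier of their source.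
\<close>

definition Ab :: "('u monoid, 'u \<Rightarrow> 'u) addcat" where
  "Ab =
    \<lparr>Ob = {G. comm_group G},
     HomG = (\<lambda>G H. \<lparr>carrier = hom G H \<inter> extensional (carrier G),
        mult = (\<lambda>f g. \<lambda>x \<in> carrier G. f x \<otimes>\<^bsub>H\<^esub> g x),
        one = (\<lambda>x \<in> carrier G. \<one>\<^bsub>H\<^esub>)\<rparr>),
     Idt = (\<lambda>G. \<lambda>x \<in> carrier G. x),
     Cmp = (\<lambda>G H K f g. compose (carrier G) g f)\<rparr>"

type_synonym ('o, 'm, 'u) modl = "('o, 'm, 'u monoid, 'u \<Rightarrow> 'u) fnctr"

definition Mod_cat :: "('o, 'm) addcat \<Rightarrow> (('o, 'm, 'u) modl, 'o \<Rightarrow> 'u \<Rightarrow> 'u) addcat" where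
  "Mod_cat P = functor_category (op_category P) Ab"


section \<open>Representable functors\<close>

text \<open>
  Hom groups have elements in \<open>'m\<close> and their subquotients have elements in \<open>'m set\<close>. To see
  them in the universe \<open>'u\<close>, an injection \<open>e :: 'm set \<Rightarrow> 'u\<close> is fixed; elements of \<open>'m\<close> are sent
  to \<open>'u\<close> via their singletons. The injection says that \<open>P\<close> is small relative to the universe \<open>'u\<close>.
\<close>

definition copy_group :: "('x \<Rightarrow> 'u) \<Rightarrow> 'x monoid \<Rightarrow> 'u monoid" where
  "copy_group j G =
    \<lparr>carrier = j ` carrier G, mult = (\<lambda>x y. j (inv_into UNIV j x \<otimes>\<^bsub>G\<^esub> inv_into UNIV j y)), one = j \<one>\<^bsub>G\<^esub>\<rparr>"

definition copy_map :: "('x \<Rightarrow> 'u) \<Rightarrow> ('y \<Rightarrow> 'u) \<Rightarrow> 'x set \<Rightarrow> ('x \<Rightarrow> 'y) \<Rightarrow> 'u \<Rightarrow> 'u" where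
  "copy_map j k A f = (\<lambda>x \<in> j ` A. k (f (inv_into UNIV j x)))"

definition single :: "('m set \<Rightarrow> 'u) \<Rightarrow> 'm \<Rightarrow> 'u" where
  "single e x = e {x}"

text \<open>A morphism \<open>f\<close> from \<open>S\<close> to \<open>T\<close> in the opposite category is a morphism from \<open>T\<close> to \<open>S\<close> in \<open>P\<close>.\<close>

definition yoneda_obj :: "('m set \<Rightarrow> 'u) \<Rightarrow> ('o, 'm) addcat \<Rightarrow> 'o \<Rightarrow> ('o, 'm, 'u) modl" where
  "yoneda_obj e P A =
    \<lparr>FOb = (\<lambda>T. copy_group (single e) (HomG P T A)),
     FMor = (\<lambda>S T f. copy_map (single e) (single e) (Hom P S A) (\<lambda>x. Cmp P T S A f x))\<rparr>"

definition yoneda_mor ::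
  "('m set \<Rightarrow> 'u) \<Rightarrow> ('o, 'm) addcat \<Rightarrow> 'o \<Rightarrow> 'o \<Rightarrow> 'm \<Rightarrow> 'o \<Rightarrow> 'u \<Rightarrow> 'u" where
  "yoneda_mor e P A B \<alpha> =
    (\<lambda>T \<in> Ob P. copy_map (single e) (single e) (Hom P T A) (\<lambda>x. Cmp P T A B x \<alpha>))"


section \<open>The category of cospans modulo its ideal\<close>

record ('o, 'm) cospan =
  Src :: 'o
  Mid :: 'o
  Rel :: 'o
  gam :: 'm
  rho :: 'm

definition cospans :: "('o, 'm) addcat \<Rightarrow> ('o, 'm) cospan set" where
  "cospans P = {X. Src X \<in> Ob P \<and> Mid X \<in> Ob P \<and> Rel X \<in> Ob P \<and>
    gam X \<in> Hom P (Src X) (Mid X) \<and> rho X \<in> Hom P (Rel X) (Mid X)}"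

text \<open>The objects of the category of syzygies; only these are used below.\<close>

definition Syz :: "('o, 'm) addcat \<Rightarrow> ('o, 'm) cospan \<Rightarrow> ('o \<times> 'm) set" where
  "Syz P X = {(S, \<sigma>). S \<in> Ob P \<and> \<sigma> \<in> Hom P S (Src X) \<and>
    (\<exists>\<omega> \<in> Hom P S (Rel X). Cmp P S (Src X) (Mid X) \<sigma> (gam X) = Cmp P S (Rel X) (Mid X) \<omega> (rho X))}"

definition Aux_hom :: "('o, 'm) addcat \<Rightarrow> ('o, 'm) cospan \<Rightarrow> ('o, 'm) cospan \<Rightarrow> 'm set" where
  "Aux_hom P X Y = {\<alpha> \<in> Hom P (Src X) (Src Y).
    \<forall>(S, \<sigma>) \<in> Syz P X. (S, Cmp P S (Src X) (Src Y) \<sigma> \<alpha>) \<in> Syz P Y}"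

definition Aux_cat :: "('o, 'm) addcat \<Rightarrow> (('o, 'm) cospan, 'm) addcat" where
  "Aux_cat P =
    \<lparr>Ob = cospans P,
     HomG = (\<lambda>X Y. (HomG P (Src X) (Src Y))\<lparr>carrier := Aux_hom P X Y\<rparr>),
     Idt = (\<lambda>X. Idt P (Src X)),
     Cmp = (\<lambda>X Y Z. Cmp P (Src X) (Src Y) (Src Z))\<rparr>"

definition Aux_ideal :: "('o, 'm) addcat \<Rightarrow> ('o, 'm) cospan \<Rightarrow> ('o, 'm) cospan \<Rightarrow> 'm set" where
  "Aux_ideal P X Y = {\<alpha> \<in> Aux_hom P X Y. \<exists>\<zeta> \<in> Hom P (Src X) (Rel Y).
    Cmp P (Src X) (Src Y) (Mid Y) \<alpha> (gam Y) = Cmp P (Src X) (Rel Y) (Mid Y) \<zeta> (rho Y)}"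

text \<open>For an ideal \<open>I\<close>, all cosets in the union defining the composite coincide.\<close>

definition quotient_category ::
  "('o, 'm) addcat \<Rightarrow> ('o \<Rightarrow> 'o \<Rightarrow> 'm set) \<Rightarrow> ('o, 'm set) addcat" where
  "quotient_category C I =
    \<lparr>Ob = Ob C,
     HomG = (\<lambda>X Y. HomG C X Y Mod I X Y),
     Idt = (\<lambda>X. I X X #>\<^bsub>HomG C X X\<^esub> Idt C X),
     Cmp = (\<lambda>X Y Z u v. \<Union>f \<in> u. \<Union>g \<in> v. I X Z #>\<^bsub>HomG C X Z\<^esub> Cmp C X Y Z f g)\<rparr>"

definition Q_cat :: "('o, 'm) addcat \<Rightarrow> (('o, 'm) cospan, 'm set) addcat" where
  "Q_cat P = quotient_category (Aux_cat P) (Aux_ideal P)"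


section \<open>The functor from cospans to modules\<close>

text \<open>The value at \<open>T\<close> of the image of \<open>(-, f)\<close> for \<open>f\<close> from \<open>A\<close> to \<open>B\<close>, as a subgroup of \<open>(T, B)\<close>.\<close>

definition im_at :: "('o, 'm) addcat \<Rightarrow> 'o \<Rightarrow> 'o \<Rightarrow> 'm \<Rightarrow> 'o \<Rightarrow> 'm set" where
  "im_at P A B f T = (\<lambda>x. Cmp P T A B x f) ` Hom P T A"

definition im_gam :: "('o, 'm) addcat \<Rightarrow> ('o, 'm) cospan \<Rightarrow> 'o \<Rightarrow> 'm monoid" where
  "im_gam P X T = (HomG P T (Mid X))\<lparr>carrier := im_at P (Src X) (Mid X) (gam X) T\<rparr>"

definition im_cap :: "('o, 'm) addcat \<Rightarrow> ('o, 'm) cospan \<Rightarrow> 'o \<Rightarrow> 'm set" where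
  "im_cap P X T = im_at P (Rel X) (Mid X) (rho X) T \<inter> im_at P (Src X) (Mid X) (gam X) T"

definition Mbar_obj :: "('m set \<Rightarrow> 'u) \<Rightarrow> ('o, 'm) addcat \<Rightarrow> ('o, 'm) cospan \<Rightarrow> ('o, 'm, 'u) modl"
  where
  "Mbar_obj e P X =
    \<lparr>FOb = (\<lambda>T. copy_group e (im_gam P X T Mod im_cap P X T)),
     FMor = (\<lambda>S T f. copy_map e e (carrier (im_gam P X S Mod im_cap P X S))
        (\<lambda>c. \<Union>x \<in> c. im_cap P X T #>\<^bsub>im_gam P X T\<^esub> Cmp P T S (Mid X) f x))\<rparr>"

definition eps :: "('m set \<Rightarrow> 'u) \<Rightarrow> ('o, 'm) addcat \<Rightarrow> ('o, 'm) cospan \<Rightarrow> 'o \<Rightarrow> 'u \<Rightarrow> 'u" where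
  "eps e P X = (\<lambda>T \<in> Ob P. copy_map (single e) e (Hom P T (Src X))
    (\<lambda>x. im_cap P X T #>\<^bsub>im_gam P X T\<^esub> Cmp P T (Src X) (Mid X) x (gam X)))"

definition Mbar ::
  "('m set \<Rightarrow> 'u) \<Rightarrow> ('o, 'm) addcat
    \<Rightarrow> (('o, 'm) cospan, 'm set, ('o, 'm, 'u) modl, 'o \<Rightarrow> 'u \<Rightarrow> 'u) fnctr" where
  "Mbar e P =
    \<lparr>FOb = Mbar_obj e P,
     FMor = (\<lambda>X Y u. THE \<eta>. \<eta> \<in> Hom (Mod_cat P) (Mbar_obj e P X) (Mbar_obj e P Y) \<and>
       (\<forall>\<alpha> \<in> u.
         Cmp (Mod_cat P) (yoneda_obj e P (Src X)) (Mbar_obj e P X) (Mbar_obj e P Y) (eps e P X) \<eta>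
         = Cmp (Mod_cat P) (yoneda_obj e P (Src X)) (yoneda_obj e P (Src Y)) (Mbar_obj e P Y)
             (yoneda_mor e P (Src X) (Src Y) \<alpha>) (eps e P Y)))\<rparr>"

end

theory Submission
  imports Defs
begin

text \<open>
  By the Yoneda lemma, the modules isomorphic to some \<open>Mbar_obj e P X\<close> are those generated by a single
  element \<open>w\<close> over an object \<open>A\<close> whose annihilator \<open>{\<sigma>. \<sigma> w = 0}\<close> is the collection of syzygies of a cospan
  \<open>A \<rightarrow> \<Omega> \<leftarrow> R\<close>, and a map out of such a module is an element killed by the syzygies. Hence cokernels,
  images and biproducts amount to explicit operations on cospans: the cokernel of the map
  induced by \<open>\<alpha> : A \<rightarrow> B\<close> is presented by \<open>B \<rightarrow> \<Omega>\<^sub>B \<leftarrow> R\<^sub>B \<oplus> A\<close>, and its image by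
  \<open>A \<rightarrow> \<Omega>\<^sub>B \<leftarrow> R\<^sub>B\<close>. Conversely, the module presented by \<open>A \<rightarrow> \<Omega> \<leftarrow> R\<close> is the image of
  \<open>(-, A) \<rightarrow> (-, \<Omega>) \<rightarrow> coker((-, R) \<rightarrow> (-, \<Omega>))\<close>, so it lies in every subcategory with the closure
  properties.
\<close>

section \<open>Modules elementwise\<close>

text \<open>Write \<open>\<sigma> w\<close> for \<open>FMor W A T \<sigma> w\<close>. Morphisms of
  an additive category need not have weak kernels, so the annihilator of a generator need not be
  finitely generated, and relations cannot be handled as matrices over the category. What a cospan
  offers instead is a test: \<open>\<sigma> w = 0\<close> exactly if
  \<open>\<sigma> \<gamma>\<close> factors through \<open>\<rho>\<close>. Every construction below
  adjusts \<open>\<gamma>\<close> and \<open>\<rho>\<close> until this test describes the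
  annihilator that the new generator must have.

  A second obstacle is that closure under cokernels and images speaks of all objects with the
  universal property. Exactness is therefore computed for one explicit cokernel and carried to every
  other one by uniqueness; kernels of cokernels are compared with a presented module in the same
  way.

  The essential image is full and replete, hence known once the isomorphism classes of its objects
  are. The predicate \<open>presentable\<close> describes these objects by a generator and a syzygy
  test alone, so that it can be checked without producing an isomorphism.\<close>

lemma op_category_simps [simp]:
  "Ob (op_category C) = Ob C" "HomG (op_category C) X Y = HomG C Y X"
  "Idt (op_category C) = Idt C" "Cmp (op_category C) X Y Z f g = Cmp C Z Y X g f"
  by (simp_all add: op_category_def)

lemma Ab_simps [simp]:
  "Ob Ab = {G. comm_group G}"
  "carrier (HomG Ab G H) = hom G H \<inter> extensional (carrier G)"
  "f \<otimes>\<^bsub>HomG Ab G H\<^esub> g = (\<lambda>x \<in> carrier G. f x \<otimes>\<^bsub>H\<^esub> g x)"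
  "\<one>\<^bsub>HomG Ab G H\<^esub> = (\<lambda>x \<in> carrier G. \<one>\<^bsub>H\<^esub>)"
  "Idt Ab G = (\<lambda>x \<in> carrier G. x)"
  "Cmp Ab G H K f g = compose (carrier G) g f"
  by (simp_all add: Ab_def)

lemma compose_eq_iff: "compose A g f = compose A k h \<longleftrightarrow> (\<forall>x \<in> A. g (f x) = k (h x))"
  unfolding compose_def restrict_def by metis

context preadditive_category
begin

text \<open>A morphism \<open>f\<close> from \<open>T\<close> to \<open>S\<close> acts from
  \<open>FOb W S\<close> to \<open>FOb W T\<close>, as for a module over a ring with many objects;
  the clauses are the module axioms for this action. Extensionality is what turns the elementwise
  laws back into equations between morphisms of \<open>Ab\<close>.\<close>

lemma mem_Ob_Mod:
  "W \<in> Ob (Mod_cat C) \<longleftrightarrow>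
    (\<forall>T \<in> Ob C. comm_group (FOb W T)) \<and>
    (\<forall>S \<in> Ob C. \<forall>T \<in> Ob C. \<forall>f \<in> Hom C T S.
      FMor W S T f \<in> hom (FOb W S) (FOb W T) \<inter> extensional (carrier (FOb W S))) \<and>
    (\<forall>S \<in> Ob C. \<forall>T \<in> Ob C. \<forall>f \<in> Hom C T S. \<forall>g \<in> Hom C T S. \<forall>w \<in> carrier (FOb W S).
      FMor W S T (f \<otimes>\<^bsub>HomG C T S\<^esub> g) w = FMor W S T f w \<otimes>\<^bsub>FOb W T\<^esub> FMor W S T g w) \<and>
    (\<forall>T \<in> Ob C. \<forall>w \<in> carrier (FOb W T). FMor W T T (Idt C T) w = w) \<and>
    (\<forall>S \<in> Ob C. \<forall>T \<in> Ob C. \<forall>U \<in> Ob C. \<forall>f \<in> Hom C T S. \<forall>g \<in> Hom C U T.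
      \<forall>w \<in> carrier (FOb W S).
      FMor W S U (Cmp C U T S g f) w = FMor W T U g (FMor W S T f w))"
  (is "_ \<longleftrightarrow> ?G \<and> ?H \<and> ?A \<and> ?I \<and> ?C")
proof
  assume "W \<in> Ob (Mod_cat C)"
  then have F: "additive_functor (op_category C) Ab W"
    by (simp add: Mod_cat_def functor_category_def)
  have h: "FMor W S T \<in> hom (HomG C T S) (HomG Ab (FOb W S) (FOb W T))"
    if "S \<in> Ob C" "T \<in> Ob C" for S T
    using F that by (simp add: additive_functor_def)
  have ?G using F by (simp add: additive_functor_def)
  moreover have ?H using hom_in_carrier[OF h] by simp
  moreover have ?A using hom_mult[OF h] by simp
  moreover have ?I using F by (simp add: additive_functor_def)
  moreover have ?C using F by (simp add: additive_functor_def compose_def)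
  ultimately show "?G \<and> ?H \<and> ?A \<and> ?I \<and> ?C" by blast
next
  assume *: "?G \<and> ?H \<and> ?A \<and> ?I \<and> ?C"
  have idt: "FMor W T T (Idt C T) = (\<lambda>x \<in> carrier (FOb W T). x)" if T: "T \<in> Ob C" for T
  proof (rule extensionalityI)
    show "FMor W T T (Idt C T) \<in> extensional (carrier (FOb W T))"
      using * idt_closed[OF T] T by blast
  qed (use * T in auto)
  have add: "FMor W S T (f \<otimes>\<^bsub>HomG C T S\<^esub> g)
      = (\<lambda>x \<in> carrier (FOb W S). FMor W S T f x \<otimes>\<^bsub>FOb W T\<^esub> FMor W S T g x)"
    if "S \<in> Ob C" "T \<in> Ob C" "f \<in> Hom C T S" "g \<in> Hom C T S" for S T f g
  proof (rule extensionalityI)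
    have "f \<otimes>\<^bsub>HomG C T S\<^esub> g \<in> Hom C T S"
      using hom_group[of T S] that by (simp add: comm_group_def group_def monoid.m_closed)
    then show "FMor W S T (f \<otimes>\<^bsub>HomG C T S\<^esub> g) \<in> extensional (carrier (FOb W S))"
      using * that by blast
  qed (use * that in auto)
  have cmp: "FMor W S U (Cmp C U T S g f) = compose (carrier (FOb W S)) (FMor W T U g) (FMor W S T f)"
    if "S \<in> Ob C" "T \<in> Ob C" "U \<in> Ob C" "f \<in> Hom C T S" "g \<in> Hom C U T" for S T U f g
  proof (rule extensionalityI)
    show "FMor W S U (Cmp C U T S g f) \<in> extensional (carrier (FOb W S))"
      using * that cmp_closed[of U T S g f] by blast
  qed (use * that in \<open>auto simp: compose_def\<close>)
  have "FMor W S T \<in> hom (HomG C T S) (HomG Ab (FOb W S) (FOb W T))"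
    if "S \<in> Ob C" "T \<in> Ob C" for S T
    using * that add by (auto simp: hom_def)
  then have "additive_functor (op_category C) Ab W"
    unfolding additive_functor_def using * idt cmp by simp
  then show "W \<in> Ob (Mod_cat C)" by (simp add: Mod_cat_def functor_category_def)
qed

section \<open>Hom groups, composition and the action on a module\<close>

lemma hom_grp: "\<lbrakk>X \<in> Ob C; Y \<in> Ob C\<rbrakk> \<Longrightarrow> group (HomG C X Y)"
  using hom_group comm_group.axioms(2) by blast

lemma add_closed: "\<lbrakk>X \<in> Ob C; Y \<in> Ob C; f \<in> Hom C X Y; g \<in> Hom C X Y\<rbrakk>
    \<Longrightarrow> f \<otimes>\<^bsub>HomG C X Y\<^esub> g \<in> Hom C X Y"
  using hom_grp by (simp add: group.is_monoid monoid.m_closed)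

lemma zero_closed: "\<lbrakk>X \<in> Ob C; Y \<in> Ob C\<rbrakk> \<Longrightarrow> ZeroM C X Y \<in> Hom C X Y"
  using hom_grp by (simp add: group.is_monoid)

lemma cmp_hom_left:
  "\<lbrakk>X \<in> Ob C; Y \<in> Ob C; Z \<in> Ob C; g \<in> Hom C Y Z\<rbrakk>
    \<Longrightarrow> group_hom (HomG C X Y) (HomG C X Z) (\<lambda>f. Cmp C X Y Z f g)"
  by (intro group_hom.intro group_hom_axioms.intro hom_grp homI) (auto simp: cmp_closed cmp_add_left)

lemma cmp_hom_right:
  "\<lbrakk>X \<in> Ob C; Y \<in> Ob C; Z \<in> Ob C; f \<in> Hom C X Y\<rbrakk>
    \<Longrightarrow> group_hom (HomG C Y Z) (HomG C X Z) (Cmp C X Y Z f)"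
  by (intro group_hom.intro group_hom_axioms.intro hom_grp homI) (auto simp: cmp_closed cmp_add_right)

lemma cmp_zero_left:
  "\<lbrakk>X \<in> Ob C; Y \<in> Ob C; Z \<in> Ob C; g \<in> Hom C Y Z\<rbrakk> \<Longrightarrow> Cmp C X Y Z (ZeroM C X Y) g = ZeroM C X Z"
  using group_hom.hom_one[OF cmp_hom_left] by blast

lemma cmp_zero_right:
  "\<lbrakk>X \<in> Ob C; Y \<in> Ob C; Z \<in> Ob C; f \<in> Hom C X Y\<rbrakk> \<Longrightarrow> Cmp C X Y Z f (ZeroM C Y Z) = ZeroM C X Z"
  using group_hom.hom_one[OF cmp_hom_right] by blast

lemmas mod_comm_group = mem_Ob_Mod[THEN iffD1, THEN conjunct1, rule_format]
  and act_hom = mem_Ob_Mod[THEN iffD1, THEN conjunct2, THEN conjunct1, rule_format, THEN IntD1]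
  and act_add = mem_Ob_Mod[THEN iffD1, THEN conjunct2, THEN conjunct2, THEN conjunct1, rule_format]
  and act_idt = mem_Ob_Mod[THEN iffD1, THEN conjunct2, THEN conjunct2, THEN conjunct2,
    THEN conjunct1, rule_format]
  and act_cmp = mem_Ob_Mod[THEN iffD1, THEN conjunct2, THEN conjunct2, THEN conjunct2,
    THEN conjunct2, rule_format]

lemma mod_group: "\<lbrakk>W \<in> Ob (Mod_cat C); T \<in> Ob C\<rbrakk> \<Longrightarrow> group (FOb W T)"
  by (rule comm_group.axioms(2)[OF mod_comm_group])

lemma act_group_hom:
  assumes "W \<in> Ob (Mod_cat C)" "S \<in> Ob C" "T \<in> Ob C" "f \<in> Hom C T S"
  shows "group_hom (FOb W S) (FOb W T) (FMor W S T f)"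
  by (intro group_hom.intro group_hom_axioms.intro mod_group act_hom assms)

lemmas act_closed = group_hom.hom_closed[OF act_group_hom]

text \<open>The map \<open>f \<mapsto> f w\<close> of the Yoneda lemma.\<close>

lemma eval_group_hom:
  assumes "W \<in> Ob (Mod_cat C)" "S \<in> Ob C" "T \<in> Ob C" "w \<in> carrier (FOb W S)"
  shows "group_hom (HomG C T S) (FOb W T) (\<lambda>f. FMor W S T f w)"
  using assms
  by (intro group_hom.intro group_hom_axioms.intro mod_group hom_grp homI)
    (simp_all add: act_closed act_add)

section \<open>Natural transformations as families of equivariant homomorphisms\<close>

lemma mem_Hom_Mod:
  "\<eta> \<in> Hom (Mod_cat C) F G \<longleftrightarrow> \<eta> \<in> extensional (Ob C) \<and>
    (\<forall>T \<in> Ob C. \<eta> T \<in> hom (FOb F T) (FOb G T) \<inter> extensional (carrier (FOb F T))) \<and>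
    (\<forall>S \<in> Ob C. \<forall>T \<in> Ob C. \<forall>f \<in> Hom C T S. \<forall>x \<in> carrier (FOb F S).
      \<eta> T (FMor F S T f x) = FMor G S T f (\<eta> S x))"
  by (auto simp: Mod_cat_def functor_category_def nat_trans_def PiE_iff compose_eq_iff)

lemma Mod_Cmp:
  "Cmp (Mod_cat C) F G H \<eta> \<theta> = (\<lambda>T \<in> Ob C. compose (carrier (FOb F T)) (\<theta> T) (\<eta> T))"
  by (simp add: Mod_cat_def functor_category_def)

lemma Mod_Cmp_apply:
  "\<lbrakk>T \<in> Ob C; x \<in> carrier (FOb F T)\<rbrakk> \<Longrightarrow> Cmp (Mod_cat C) F G H \<eta> \<theta> T x = \<theta> T (\<eta> T x)"
  by (simp add: Mod_Cmp compose_def)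

lemma Mod_Idt: "Idt (Mod_cat C) F = (\<lambda>T \<in> Ob C. \<lambda>x \<in> carrier (FOb F T). x)"
  by (simp add: Mod_cat_def functor_category_def)

lemma Mod_zero: "ZeroM (Mod_cat C) F G = (\<lambda>T \<in> Ob C. \<lambda>x \<in> carrier (FOb F T). \<one>\<^bsub>FOb G T\<^esub>)"
  by (simp add: Mod_cat_def functor_category_def)

lemma Mod_add:
  "\<eta> \<otimes>\<^bsub>HomG (Mod_cat C) F G\<^esub> \<theta>
    = (\<lambda>T \<in> Ob C. \<lambda>x \<in> carrier (FOb F T). \<eta> T x \<otimes>\<^bsub>FOb G T\<^esub> \<theta> T x)"
  by (simp add: Mod_cat_def functor_category_def)

text \<open>Extensionality occurs on two levels, for the family over \<open>Ob C\<close> and for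
  each component over its carrier, so values on elements decide equality.\<close>

lemma Mod_hom_eqI:
  assumes "\<eta> \<in> Hom (Mod_cat C) F G" "\<theta> \<in> Hom (Mod_cat C) F G"
    and "\<And>T x. \<lbrakk>T \<in> Ob C; x \<in> carrier (FOb F T)\<rbrakk> \<Longrightarrow> \<eta> T x = \<theta> T x"
  shows "\<eta> = \<theta>"
proof (rule extensionalityI)
  fix T assume T: "T \<in> Ob C"
  show "\<eta> T = \<theta> T"
    by (rule extensionalityI[where A = "carrier (FOb F T)"])
      (use assms T in \<open>auto simp: mem_Hom_Mod\<close>)
qed (use assms in \<open>auto simp: mem_Hom_Mod\<close>)

lemma nat_group_hom:
  "\<lbrakk>F \<in> Ob (Mod_cat C); G \<in> Ob (Mod_cat C); \<eta> \<in> Hom (Mod_cat C) F G; T \<in> Ob C\<rbrakk>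
    \<Longrightarrow> group_hom (FOb F T) (FOb G T) (\<eta> T)"
  by (intro group_hom.intro group_hom_axioms.intro mod_group) (auto simp: mem_Hom_Mod)

lemma nat_closed:
  "\<lbrakk>\<eta> \<in> Hom (Mod_cat C) F G; T \<in> Ob C; x \<in> carrier (FOb F T)\<rbrakk> \<Longrightarrow> \<eta> T x \<in> carrier (FOb G T)"
  by (auto simp: mem_Hom_Mod hom_def)

lemma nat_act:
  "\<lbrakk>\<eta> \<in> Hom (Mod_cat C) F G; S \<in> Ob C; T \<in> Ob C; f \<in> Hom C T S; x \<in> carrier (FOb F S)\<rbrakk>
    \<Longrightarrow> \<eta> T (FMor F S T f x) = FMor G S T f (\<eta> S x)"
  by (simp add: mem_Hom_Mod)

text \<open>The double restriction produces the required normal form. It does not disturb the laws,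
  because products and the action stay inside the carriers of \<open>F\<close>.\<close>

lemma Mod_HomI:
  assumes "\<And>T. T \<in> Ob C \<Longrightarrow> h T \<in> hom (FOb F T) (FOb G T)"
    and "\<And>S T f x. \<lbrakk>S \<in> Ob C; T \<in> Ob C; f \<in> Hom C T S; x \<in> carrier (FOb F S)\<rbrakk>
      \<Longrightarrow> h T (FMor F S T f x) = FMor G S T f (h S x)"
    and "F \<in> Ob (Mod_cat C)"
  shows "(\<lambda>T \<in> Ob C. restrict (h T) (carrier (FOb F T))) \<in> Hom (Mod_cat C) F G"
proof -
  have "restrict (h T) (carrier (FOb F T)) \<in> hom (FOb F T) (FOb G T)" if "T \<in> Ob C" for T
    using assms(1)[OF that] monoid.m_closed[OF group.is_monoid[OF mod_group[OF assms(3) that]]]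
    by (auto simp: hom_def)
  then show ?thesis
    using assms(2) act_closed[OF assms(3)] by (simp add: mem_Hom_Mod)
qed

text \<open>All operations are pointwise; sums and inverses of homomorphisms are again homomorphisms
  because the target groups are abelian. The result makes facts about preadditive categories, such
  as uniqueness of cokernels, available for the module category itself.\<close>

lemma Mod_preadditive: "preadditive_category (Mod_cat C :: (('o, 'm, 'u) modl, _) addcat)"
proof (rule preadditive_category.intro)
  let ?M = "Mod_cat C :: (('o, 'm, 'u) modl, _) addcat"
  note comm = mod_comm_group and grp = mod_group
  have mult: "\<eta> \<otimes>\<^bsub>HomG ?M F G\<^esub> \<theta> \<in> Hom ?M F G"
    if "F \<in> Ob ?M" "G \<in> Ob ?M" "\<eta> \<in> Hom ?M F G" "\<theta> \<in> Hom ?M F G" for F G \<eta> \<theta>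
    unfolding Mod_add
  proof (rule Mod_HomI)
    fix T assume T: "T \<in> Ob C"
    interpret G: comm_group "FOb G T" using comm that T by blast
    show "(\<lambda>x. \<eta> T x \<otimes>\<^bsub>FOb G T\<^esub> \<theta> T x) \<in> hom (FOb F T) (FOb G T)"
      using nat_group_hom[OF that(1,2,3) T] nat_group_hom[OF that(1,2,4) T]
      by (intro homI) (auto simp: group_hom.hom_closed group_hom.hom_mult G.m_ac
        group_hom.axioms(3) group_hom_axioms_def hom_def Pi_iff)
  next
    fix S T f x assume a: "S \<in> Ob C" "T \<in> Ob C" "f \<in> Hom C T S" "x \<in> carrier (FOb F S)"
    show "\<eta> T (FMor F S T f x) \<otimes>\<^bsub>FOb G T\<^esub> \<theta> T (FMor F S T f x)
      = FMor G S T f (\<eta> S x \<otimes>\<^bsub>FOb G S\<^esub> \<theta> S x)"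
      using a that by (simp add: nat_act nat_closed group_hom.hom_mult[OF act_group_hom])
  qed fact
  have zero: "ZeroM ?M F G \<in> Hom ?M F G" if "F \<in> Ob ?M" "G \<in> Ob ?M" for F G
    unfolding Mod_zero
    by (rule Mod_HomI) (use that in \<open>auto simp: hom_def group.is_monoid[OF grp]
      group_hom.hom_one[OF act_group_hom]\<close>)
  have minus: "(\<lambda>T \<in> Ob C. \<lambda>x \<in> carrier (FOb F T). inv\<^bsub>FOb G T\<^esub> \<eta> T x) \<in> Hom ?M F G"
    if "F \<in> Ob ?M" "G \<in> Ob ?M" "\<eta> \<in> Hom ?M F G" for F G \<eta>
  proof (rule Mod_HomI)
    fix T assume T: "T \<in> Ob C"
    interpret G: comm_group "FOb G T" using comm that T by blast
    show "(\<lambda>x. inv\<^bsub>FOb G T\<^esub> \<eta> T x) \<in> hom (FOb F T) (FOb G T)"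
      using nat_closed[OF that(3) T] group_hom.hom_mult[OF nat_group_hom[OF that T]]
      by (intro homI) (auto simp: G.inv_mult)
  qed (use that in \<open>auto simp: nat_act nat_closed group_hom.hom_inv[OF act_group_hom]\<close>)
  show "comm_group (HomG ?M F G)" if FG: "F \<in> Ob ?M" "G \<in> Ob ?M" for F G
  proof (rule comm_groupI)
    fix \<eta> assume \<eta>: "\<eta> \<in> Hom ?M F G"
    let ?i = "\<lambda>T \<in> Ob C. \<lambda>x \<in> carrier (FOb F T). inv\<^bsub>FOb G T\<^esub> \<eta> T x"
    have "?i \<otimes>\<^bsub>HomG ?M F G\<^esub> \<eta> = ZeroM ?M F G"
      by (rule Mod_hom_eqI[OF mult[OF FG minus[OF FG \<eta>] \<eta>] zero[OF FG]])
        (use FG \<eta> in \<open>auto simp: Mod_add Mod_zero nat_closed group.l_inv[OF grp]\<close>)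
    then show "\<exists>\<theta>\<in>Hom ?M F G. \<theta> \<otimes>\<^bsub>HomG ?M F G\<^esub> \<eta> = ZeroM ?M F G"
      using minus[OF FG \<eta>] by blast
    show "ZeroM ?M F G \<otimes>\<^bsub>HomG ?M F G\<^esub> \<eta> = \<eta>"
      by (rule Mod_hom_eqI[OF mult[OF FG zero[OF FG] \<eta>] \<eta>])
        (use FG \<eta> in \<open>auto simp: Mod_add Mod_zero nat_closed
          monoid.l_one[OF group.is_monoid[OF grp]]\<close>)
  next
    fix \<eta> \<theta> assume "\<eta> \<in> Hom ?M F G" "\<theta> \<in> Hom ?M F G"
    then show "\<eta> \<otimes>\<^bsub>HomG ?M F G\<^esub> \<theta> = \<theta> \<otimes>\<^bsub>HomG ?M F G\<^esub> \<eta>"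
      unfolding Mod_add by (intro restrict_ext)
        (use FG in \<open>auto simp: nat_closed comm_monoid.m_comm[OF comm_group.axioms(1)[OF comm]]\<close>)
  next
    fix \<eta> \<theta> \<zeta> assume "\<eta> \<in> Hom ?M F G" "\<theta> \<in> Hom ?M F G" "\<zeta> \<in> Hom ?M F G"
    then show "\<eta> \<otimes>\<^bsub>HomG ?M F G\<^esub> \<theta> \<otimes>\<^bsub>HomG ?M F G\<^esub> \<zeta>
        = \<eta> \<otimes>\<^bsub>HomG ?M F G\<^esub> (\<theta> \<otimes>\<^bsub>HomG ?M F G\<^esub> \<zeta>)"
      unfolding Mod_add by (intro restrict_ext)
        (use FG in \<open>auto simp: nat_closed monoid.m_assoc[OF group.is_monoid[OF grp]]\<close>)
  qed (use FG mult zero in auto)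
  show idt: "Idt ?M F \<in> Hom ?M F F" if "F \<in> Ob ?M" for F
    unfolding Mod_Idt by (rule Mod_HomI) (use that in \<open>auto simp: hom_def\<close>)
  show cmp: "Cmp ?M F G H \<eta> \<theta> \<in> Hom ?M F H"
    if "F \<in> Ob ?M" "G \<in> Ob ?M" "H \<in> Ob ?M" "\<eta> \<in> Hom ?M F G" "\<theta> \<in> Hom ?M G H" for F G H \<eta> \<theta>
    unfolding Mod_Cmp compose_def
    by (rule Mod_HomI) (use that in \<open>auto simp: hom_def nat_closed nat_act
      group_hom.hom_mult[OF nat_group_hom]\<close>)
  show "Cmp ?M F F G (Idt ?M F) \<eta> = \<eta>" if "F \<in> Ob ?M" "G \<in> Ob ?M" "\<eta> \<in> Hom ?M F G" for F G \<eta>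
    by (rule Mod_hom_eqI[OF cmp[OF that(1,1,2) idt[OF that(1)] that(3)] that(3)]) (use that in \<open>auto simp: Mod_Cmp_apply Mod_Idt\<close>)
  show "Cmp ?M F G G \<eta> (Idt ?M G) = \<eta>" if "F \<in> Ob ?M" "G \<in> Ob ?M" "\<eta> \<in> Hom ?M F G" for F G \<eta>
    by (rule Mod_hom_eqI[OF cmp[OF that(1,2,2,3) idt[OF that(2)]] that(3)])
      (use that in \<open>auto simp: Mod_Cmp_apply Mod_Idt nat_closed\<close>)
  show "Cmp ?M F H K (Cmp ?M F G H \<eta> \<theta>) \<zeta> = Cmp ?M F G K \<eta> (Cmp ?M G H K \<theta> \<zeta>)"
    if "F \<in> Ob ?M" "G \<in> Ob ?M" "H \<in> Ob ?M" "K \<in> Ob ?M"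
      "\<eta> \<in> Hom ?M F G" "\<theta> \<in> Hom ?M G H" "\<zeta> \<in> Hom ?M H K" for F G H K \<eta> \<theta> \<zeta>
    using that unfolding Mod_Cmp by (intro restrict_ext) (auto simp: compose_def nat_closed)
  show "Cmp ?M F G H (\<eta> \<otimes>\<^bsub>HomG ?M F G\<^esub> \<eta>') \<theta>
      = Cmp ?M F G H \<eta> \<theta> \<otimes>\<^bsub>HomG ?M F H\<^esub> Cmp ?M F G H \<eta>' \<theta>"
    if "F \<in> Ob ?M" "G \<in> Ob ?M" "H \<in> Ob ?M"
      "\<eta> \<in> Hom ?M F G" "\<eta>' \<in> Hom ?M F G" "\<theta> \<in> Hom ?M G H" for F G H \<eta> \<eta>' \<theta>
    by (rule Mod_hom_eqI[OF cmp[OF that(1-3) mult[OF that(1,2,4,5)] that(6)]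
          mult[OF that(1,3) cmp[OF that(1-4,6)] cmp[OF that(1-3,5,6)]]])
      (use that in \<open>auto simp: Mod_Cmp_apply Mod_add nat_closed
        group_hom.hom_mult[OF nat_group_hom]\<close>)
  show "Cmp ?M F G H \<eta> (\<theta> \<otimes>\<^bsub>HomG ?M G H\<^esub> \<theta>')
      = Cmp ?M F G H \<eta> \<theta> \<otimes>\<^bsub>HomG ?M F H\<^esub> Cmp ?M F G H \<eta> \<theta>'"
    if "F \<in> Ob ?M" "G \<in> Ob ?M" "H \<in> Ob ?M"
      "\<eta> \<in> Hom ?M F G" "\<theta> \<in> Hom ?M G H" "\<theta>' \<in> Hom ?M G H" for F G H \<eta> \<theta> \<theta>'
    by (rule Mod_hom_eqI[OF cmp[OF that(1-4) mult[OF that(2,3,5,6)]]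
          mult[OF that(1,3) cmp[OF that(1-5)] cmp[OF that(1-4,6)]]])
      (use that in \<open>auto simp: Mod_Cmp_apply Mod_add nat_closed\<close>)
qed

end

section \<open>Maps out of modules with one generator\<close>

lemma restrict_eq_iff: "restrict f A = restrict g A \<longleftrightarrow> (\<forall>x \<in> A. f x = g x)"
  by (metis restrict_apply' restrict_ext)

text \<open>Apply the inclusion of kernels to the difference of \<open>x\<close> and
  \<open>y\<close>. This is the well-definedness behind maps given on representatives.\<close>

lemma group_hom_factor:
  assumes "group_hom G H h" "group_hom G K k"
    and "\<And>x. \<lbrakk>x \<in> carrier G; h x = \<one>\<^bsub>H\<^esub>\<rbrakk> \<Longrightarrow> k x = \<one>\<^bsub>K\<^esub>"
    and "x \<in> carrier G" "y \<in> carrier G" "h x = h y"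
  shows "k x = k y"
proof -
  interpret h: group_hom G H h by fact
  interpret k: group_hom G K k by fact
  have "h (x \<otimes>\<^bsub>G\<^esub> inv\<^bsub>G\<^esub> y) = \<one>\<^bsub>H\<^esub>" using assms(4-6) by simp
  then have "k (x \<otimes>\<^bsub>G\<^esub> inv\<^bsub>G\<^esub> y) = \<one>\<^bsub>K\<^esub>" using assms(3-5) by simp
  then have "k x \<otimes>\<^bsub>K\<^esub> inv\<^bsub>K\<^esub> k y = \<one>\<^bsub>K\<^esub>" using assms(4,5) by simp
  then show ?thesis
    using assms(4,5) k.H.inv_solve_right' k.H.l_one k.hom_closed k.H.one_closed by metis
qed

context preadditive_category
begin

text \<open>By the Yoneda lemma \<open>w\<close> is a map from the representable functor of
  \<open>A\<close> to \<open>W\<close>; the condition says that this map is surjective at every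
  object.\<close>

definition generates :: "('o, 'm, 'u) modl \<Rightarrow> 'o \<Rightarrow> 'u \<Rightarrow> bool" where
  "generates W A w \<longleftrightarrow> A \<in> Ob C \<and> w \<in> carrier (FOb W A) \<and>
    (\<forall>T \<in> Ob C. \<forall>x \<in> carrier (FOb W T). \<exists>\<sigma> \<in> Hom C T A. x = FMor W A T \<sigma> w)"

lemma generates_carrier:
  assumes "W \<in> Ob (Mod_cat C)" "generates W A w" "T \<in> Ob C"
  shows "carrier (FOb W T) = (\<lambda>\<sigma>. FMor W A T \<sigma> w) ` Hom C T A"
proof
  show "carrier (FOb W T) \<subseteq> (\<lambda>\<sigma>. FMor W A T \<sigma> w) ` Hom C T A"
    using assms(2,3) unfolding generates_def by blast
  show "(\<lambda>\<sigma>. FMor W A T \<sigma> w) ` Hom C T A \<subseteq> carrier (FOb W T)"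
    using act_closed[OF assms(1) _ assms(3)] assms(2) unfolding generates_def by blast
qed

lemma hom_eq_on_generator:
  assumes "generates W A w" "\<eta> \<in> Hom (Mod_cat C) W V" "\<theta> \<in> Hom (Mod_cat C) W V" "\<eta> A w = \<theta> A w"
  shows "\<eta> = \<theta>"
proof (rule Mod_hom_eqI[OF assms(2,3)])
  fix T x assume T: "T \<in> Ob C" and "x \<in> carrier (FOb W T)"
  then obtain \<sigma> where "\<sigma> \<in> Hom C T A" "x = FMor W A T \<sigma> w"
    using assms(1) by (auto simp: generates_def)
  then show "\<eta> T x = \<theta> T x"
    using nat_act[OF assms(2) _ T] nat_act[OF assms(3) _ T] assms(1,4) by (simp add: generates_def)
qed

text \<open>\<open>W\<close> is the quotient of the representable functor of \<open>A\<close> by the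
  annihilator of \<open>w\<close>. The assignment \<open>\<sigma> w \<mapsto> \<sigma> v\<close> is
  well defined as soon as the annihilator of \<open>w\<close> is contained in that of
  \<open>v\<close>.\<close>

lemma ex_hom_from_generated:
  assumes W: "W \<in> Ob (Mod_cat C)" and V: "V \<in> Ob (Mod_cat C)"
    and gen: "generates W A w" and v: "v \<in> carrier (FOb V A)"
    and ann: "\<And>T \<sigma>. \<lbrakk>T \<in> Ob C; \<sigma> \<in> Hom C T A; FMor W A T \<sigma> w = \<one>\<^bsub>FOb W T\<^esub>\<rbrakk>
      \<Longrightarrow> FMor V A T \<sigma> v = \<one>\<^bsub>FOb V T\<^esub>"
  shows "\<exists>\<eta> \<in> Hom (Mod_cat C) W V. \<eta> A w = v"
proof -
  have A: "A \<in> Ob C" and w: "w \<in> carrier (FOb W A)" using gen by (auto simp: generates_def)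
  \<comment> \<open>A representative \<open>\<sigma>\<close> of \<open>x\<close> is chosen. The next
    fact shows that the choice is immaterial: two representatives differ by an annihilator of
    \<open>w\<close>, hence of \<open>v\<close>.\<close>
  define h where "h T x = FMor V A T (SOME \<sigma>. \<sigma> \<in> Hom C T A \<and> x = FMor W A T \<sigma> w) v" for T x
  have h: "h T (FMor W A T \<sigma> w) = FMor V A T \<sigma> v" if T: "T \<in> Ob C" and \<sigma>: "\<sigma> \<in> Hom C T A" for T \<sigma>
  proof -
    let ?\<tau> = "SOME \<tau>. \<tau> \<in> Hom C T A \<and> FMor W A T \<sigma> w = FMor W A T \<tau> w"
    have \<tau>: "?\<tau> \<in> Hom C T A \<and> FMor W A T \<sigma> w = FMor W A T ?\<tau> w"
      by (rule someI[of _ \<sigma>]) (use \<sigma> in simp)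
    show ?thesis unfolding h_def
      by (rule group_hom_factor[OF eval_group_hom[OF W A T w] eval_group_hom[OF V A T v] ann[OF T]])
        (use \<tau> \<sigma> in auto)
  qed
  let ?\<eta> = "\<lambda>T \<in> Ob C. restrict (h T) (carrier (FOb W T))"
  have rep: "\<exists>\<sigma> \<in> Hom C T A. x = FMor W A T \<sigma> w" if "T \<in> Ob C" "x \<in> carrier (FOb W T)" for T x
    using gen that by (simp add: generates_def)
  have "?\<eta> \<in> Hom (Mod_cat C) W V"
  proof (rule Mod_HomI[OF _ _ W])
    fix T assume T: "T \<in> Ob C"
    interpret ev: group_hom "HomG C T A" "FOb W T" "\<lambda>\<sigma>. FMor W A T \<sigma> w"
      by (rule eval_group_hom[OF W A T w])
    interpret ev': group_hom "HomG C T A" "FOb V T" "\<lambda>\<sigma>. FMor V A T \<sigma> v"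
      by (rule eval_group_hom[OF V A T v])
    show "h T \<in> hom (FOb W T) (FOb V T)"
    proof (rule homI)
      fix x assume "x \<in> carrier (FOb W T)"
      then obtain \<sigma> where \<sigma>: "\<sigma> \<in> Hom C T A" "x = FMor W A T \<sigma> w" using rep T by blast
      then show "h T x \<in> carrier (FOb V T)" using h T by simp
      fix y assume "y \<in> carrier (FOb W T)"
      then obtain \<tau> where \<tau>: "\<tau> \<in> Hom C T A" "y = FMor W A T \<tau> w" using rep T by blast
      show "h T (x \<otimes>\<^bsub>FOb W T\<^esub> y) = h T x \<otimes>\<^bsub>FOb V T\<^esub> h T y"
        using h[OF T, of "\<sigma> \<otimes>\<^bsub>HomG C T A\<^esub> \<tau>"] \<sigma> \<tau> h[OF T] by simp
    qed
  next
    fix S T f x assume S: "S \<in> Ob C" and T: "T \<in> Ob C" and f: "f \<in> Hom C T S"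
      and "x \<in> carrier (FOb W S)"
    then obtain \<sigma> where \<sigma>: "\<sigma> \<in> Hom C S A" "x = FMor W A S \<sigma> w" using rep by blast
    show "h T (FMor W S T f x) = FMor V S T f (h S x)"
      using h[OF T cmp_closed[OF T S A f \<sigma>(1)]] h[OF S \<sigma>(1)] \<sigma>(2)
        act_cmp[OF W A S T \<sigma>(1) f w] act_cmp[OF V A S T \<sigma>(1) f v] by simp
  qed
  moreover have "?\<eta> A w = v"
    using h[OF A idt_closed[OF A]] A w act_idt[OF W A w] act_idt[OF V A v] by simp
  ultimately show ?thesis by blast
qed

lemma iso_inverseD:
  assumes "is_iso (Mod_cat C) W V \<eta>"
  obtains \<theta> where "\<eta> \<in> Hom (Mod_cat C) W V" "\<theta> \<in> Hom (Mod_cat C) V W"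
    "\<forall>T \<in> Ob C. \<forall>x \<in> carrier (FOb W T). \<theta> T (\<eta> T x) = x"
    "\<forall>T \<in> Ob C. \<forall>y \<in> carrier (FOb V T). \<eta> T (\<theta> T y) = y"
proof -
  obtain \<theta> where \<eta>: "\<eta> \<in> Hom (Mod_cat C) W V" and \<theta>: "\<theta> \<in> Hom (Mod_cat C) V W"
    and 1: "Cmp (Mod_cat C) W V W \<eta> \<theta> = Idt (Mod_cat C) W"
    and 2: "Cmp (Mod_cat C) V W V \<theta> \<eta> = Idt (Mod_cat C) V"
    using assms by (auto simp: is_iso_def)
  have "\<theta> T (\<eta> T x) = x" if "T \<in> Ob C" "x \<in> carrier (FOb W T)" for T x
    using Mod_Cmp_apply[OF that, of V W \<eta> \<theta>] that by (simp add: 1 Mod_Idt)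
  moreover have "\<eta> T (\<theta> T y) = y" if "T \<in> Ob C" "y \<in> carrier (FOb V T)" for T y
    using Mod_Cmp_apply[OF that, of W V \<theta> \<eta>] that by (simp add: 2 Mod_Idt)
  ultimately show thesis using that \<eta> \<theta> by blast
qed

text \<open>Each inclusion of annihilators gives a map in one direction. Both composites fix a
  generator, so they are identities.\<close>

lemma ex_iso_generated:
  fixes W V :: "('o, 'm, 'u) modl"
  assumes W: "W \<in> Ob (Mod_cat C)" and V: "V \<in> Ob (Mod_cat C)"
    and gW: "generates W A w" and gV: "generates V A v"
    and ann: "\<And>T \<sigma>. \<lbrakk>T \<in> Ob C; \<sigma> \<in> Hom C T A\<rbrakk>
      \<Longrightarrow> FMor W A T \<sigma> w = \<one>\<^bsub>FOb W T\<^esub> \<longleftrightarrow> FMor V A T \<sigma> v = \<one>\<^bsub>FOb V T\<^esub>"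
  shows "\<exists>\<eta>. is_iso (Mod_cat C) W V \<eta>"
proof -
  interpret M: preadditive_category "Mod_cat C :: (('o, 'm, 'u) modl, _) addcat" by (rule Mod_preadditive)
  have A: "A \<in> Ob C" and w: "w \<in> carrier (FOb W A)" and v: "v \<in> carrier (FOb V A)"
    using gW gV by (auto simp: generates_def)
  obtain \<eta> where \<eta>: "\<eta> \<in> Hom (Mod_cat C) W V" "\<eta> A w = v"
    using ex_hom_from_generated[OF W V gW v] ann by blast
  obtain \<theta> where \<theta>: "\<theta> \<in> Hom (Mod_cat C) V W" "\<theta> A v = w"
    using ex_hom_from_generated[OF V W gV w] ann by blast
  have "Cmp (Mod_cat C) W V W \<eta> \<theta> = Idt (Mod_cat C) W"
    by (rule hom_eq_on_generator[OF gW M.cmp_closed[OF W V W \<eta>(1) \<theta>(1)] M.idt_closed[OF W]])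
      (simp add: Mod_Cmp_apply Mod_Idt A w \<eta> \<theta>)
  moreover have "Cmp (Mod_cat C) V W V \<theta> \<eta> = Idt (Mod_cat C) V"
    by (rule hom_eq_on_generator[OF gV M.cmp_closed[OF V W V \<theta>(1) \<eta>(1)] M.idt_closed[OF V]])
      (simp add: Mod_Cmp_apply Mod_Idt A v \<eta> \<theta>)
  ultimately show ?thesis using \<eta> \<theta> by (auto simp: is_iso_def)
qed

section \<open>Kernels, cokernels and images of modules\<close>

text \<open>The isomorphism is compatible with \<open>q\<close> and \<open>r\<close>; this is what
  allows knowledge about the zeros of one cokernel map to be transferred to any other.\<close>

lemma cokernel_unique:
  assumes X: "X \<in> Ob C" and Y: "Y \<in> Ob C" and f: "f \<in> Hom C X Y"
    and K: "is_cokernel C X Y f K q" and L: "is_cokernel C X Y f L r"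
  shows "\<exists>s. is_iso C K L s \<and> Cmp C Y K L q s = r"
proof -
  have fac: "\<exists>s \<in> Hom C K L. Cmp C Y K L q s = r"
    if "is_cokernel C X Y f K q" "is_cokernel C X Y f L r" for K q L r
    using that unfolding is_cokernel_def by blast
  have id: "s = Idt C K" if "is_cokernel C X Y f K q" "s \<in> Hom C K K" "Cmp C Y K K q s = q" for K q s
    using that idt_closed[of K] idt_right[of Y K q] Y unfolding is_cokernel_def by blast
  note D = K[unfolded is_cokernel_def] L[unfolded is_cokernel_def]
  obtain s where s: "s \<in> Hom C K L" "Cmp C Y K L q s = r" using fac[OF K L] by blast
  obtain t where t: "t \<in> Hom C L K" "Cmp C Y L K r t = q" using fac[OF L K] by blast
  have "Cmp C K L K s t = Idt C K"
    by (rule id[OF K]) (use D Y s t cmp_assoc[of Y K L K q s t] in \<open>auto intro: cmp_closed\<close>)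
  moreover have "Cmp C L K L t s = Idt C L"
    by (rule id[OF L]) (use D Y s t cmp_assoc[of Y L K L r t s] in \<open>auto intro: cmp_closed\<close>)
  ultimately show ?thesis using s t by (auto simp: is_iso_def)
qed

lemma kernel_unique:
  assumes X: "X \<in> Ob C" and Y: "Y \<in> Ob C" and f: "f \<in> Hom C X Y"
    and K: "is_kernel C X Y f K k" and L: "is_kernel C X Y f L l"
  shows "\<exists>s. is_iso C K L s"
proof -
  have fac: "\<exists>s \<in> Hom C K L. Cmp C K L X s l = k"
    if "is_kernel C X Y f K k" "is_kernel C X Y f L l" for K k L l
    using that unfolding is_kernel_def by blast
  have id: "s = Idt C K" if "is_kernel C X Y f K k" "s \<in> Hom C K K" "Cmp C K K X s k = k" for K k s
    using that idt_closed[of K] idt_left[of K X k] X unfolding is_kernel_def by blast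
  note D = K[unfolded is_kernel_def] L[unfolded is_kernel_def]
  obtain s where s: "s \<in> Hom C K L" "Cmp C K L X s l = k" using fac[OF K L] by blast
  obtain t where t: "t \<in> Hom C L K" "Cmp C L K X t k = l" using fac[OF L K] by blast
  have "Cmp C K L K s t = Idt C K"
    by (rule id[OF K]) (use D X s t cmp_assoc[of K L K X s t k] in \<open>auto intro: cmp_closed\<close>)
  moreover have "Cmp C L K L t s = Idt C L"
    by (rule id[OF L]) (use D X s t cmp_assoc[of L K L X t s l] in \<open>auto intro: cmp_closed\<close>)
  ultimately show ?thesis using s t by (auto simp: is_iso_def)
qed

section \<open>Elementwise criteria for cokernels, kernels and images of modules\<close>

lemma Cmp_eq_zero_iff:
  "Cmp (Mod_cat C) X Y W f u = ZeroM (Mod_cat C) X W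
    \<longleftrightarrow> (\<forall>T \<in> Ob C. \<forall>x \<in> carrier (FOb X T). u T (f T x) = \<one>\<^bsub>FOb W T\<^esub>)"
  by (simp add: Mod_Cmp Mod_zero compose_def restrict_eq_iff)

text \<open>Let \<open>u\<close> kill \<open>f\<close>. A factorization of \<open>u\<close> through
  \<open>t\<close> must send \<open>t y\<close> to \<open>u y\<close>, and this is admissible: if
  \<open>\<sigma>\<close> annihilates \<open>t y\<close>, then \<open>\<sigma> y\<close> lies in the
  image of \<open>f\<close>, so \<open>u\<close> kills it. Having generators of \<open>Y\<close> and
  \<open>K\<close> also settles uniqueness by a look at one element.\<close>

lemma is_cokernelI:
  fixes X Y K :: "('o, 'm, 'u) modl"
  assumes Y: "Y \<in> Ob (Mod_cat C)" and K: "K \<in> Ob (Mod_cat C)"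
    and f: "f \<in> Hom (Mod_cat C) X Y" and t: "t \<in> Hom (Mod_cat C) Y K"
    and gY: "generates Y A y" and gK: "generates K A (t A y)"
    and ex: "\<And>T b. \<lbrakk>T \<in> Ob C; b \<in> carrier (FOb Y T)\<rbrakk>
      \<Longrightarrow> t T b = \<one>\<^bsub>FOb K T\<^esub> \<longleftrightarrow> b \<in> f T ` carrier (FOb X T)"
  shows "is_cokernel (Mod_cat C) X Y f K t"
  unfolding is_cokernel_def
proof (intro conjI ballI impI)
  interpret M: preadditive_category "Mod_cat C :: (('o, 'm, 'u) modl, _) addcat" by (rule Mod_preadditive)
  have A: "A \<in> Ob C" and y: "y \<in> carrier (FOb Y A)" using gY by (auto simp: generates_def)
  show "Cmp (Mod_cat C) X Y K f t = ZeroM (Mod_cat C) X K"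
    using ex nat_closed[OF f] by (simp add: Cmp_eq_zero_iff)
  fix W :: "('o, 'm, 'u) modl" and u
  assume W: "W \<in> Ob (Mod_cat C)" and u: "u \<in> Hom (Mod_cat C) Y W"
    and "Cmp (Mod_cat C) X Y W f u = ZeroM (Mod_cat C) X W"
  then have zero: "u T (f T x) = \<one>\<^bsub>FOb W T\<^esub>" if "T \<in> Ob C" "x \<in> carrier (FOb X T)" for T x
    using that by (simp add: Cmp_eq_zero_iff)
  have "\<exists>s \<in> Hom (Mod_cat C) K W. s A (t A y) = u A y"
  proof (rule ex_hom_from_generated[OF K W gK nat_closed[OF u A y]])
    fix T \<sigma> assume T: "T \<in> Ob C" and \<sigma>: "\<sigma> \<in> Hom C T A"
      and "FMor K A T \<sigma> (t A y) = \<one>\<^bsub>FOb K T\<^esub>"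
    then have "t T (FMor Y A T \<sigma> y) = \<one>\<^bsub>FOb K T\<^esub>" by (simp add: nat_act[OF t A T \<sigma> y])
    then obtain x where "x \<in> carrier (FOb X T)" "FMor Y A T \<sigma> y = f T x"
      using ex[OF T act_closed[OF Y A T \<sigma> y]] by blast
    then show "FMor W A T \<sigma> (u A y) = \<one>\<^bsub>FOb W T\<^esub>"
      using nat_act[OF u A T \<sigma> y] zero[OF T] by simp
  qed
  then obtain s where s: "s \<in> Hom (Mod_cat C) K W" "s A (t A y) = u A y" by blast
  show "\<exists>!s. s \<in> Hom (Mod_cat C) K W \<and> Cmp (Mod_cat C) Y K W t s = u"
  proof (rule ex1I[of _ s])
    have "Cmp (Mod_cat C) Y K W t s = u"
      by (rule hom_eq_on_generator[OF gY M.cmp_closed[OF Y K W t s(1)] u])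
        (simp add: Mod_Cmp_apply A y s)
    then show "s \<in> Hom (Mod_cat C) K W \<and> Cmp (Mod_cat C) Y K W t s = u" using s by blast
  next
    fix s' assume s': "s' \<in> Hom (Mod_cat C) K W \<and> Cmp (Mod_cat C) Y K W t s' = u"
    then have "s' A (t A y) = u A y" using Mod_Cmp_apply[OF A y, where \<eta> = t and \<theta> = s'] by metis
    then show "s' = s" using hom_eq_on_generator[OF gK] s s' by metis
  qed
qed fact+

text \<open>A pointwise injective map whose image is the zero set of \<open>q\<close> is a kernel,
  as in the category of abelian groups.\<close>

lemma is_kernelI:
  fixes I Y K :: "('o, 'm, 'u) modl"
  assumes I: "I \<in> Ob (Mod_cat C)" and Y: "Y \<in> Ob (Mod_cat C)"
    and q: "q \<in> Hom (Mod_cat C) Y K" and j: "j \<in> Hom (Mod_cat C) I Y"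
    and inj: "\<And>T. T \<in> Ob C \<Longrightarrow> inj_on (j T) (carrier (FOb I T))"
    and ex: "\<And>T b. \<lbrakk>T \<in> Ob C; b \<in> carrier (FOb Y T)\<rbrakk>
      \<Longrightarrow> q T b = \<one>\<^bsub>FOb K T\<^esub> \<longleftrightarrow> b \<in> j T ` carrier (FOb I T)"
  shows "is_kernel (Mod_cat C) Y K q I j"
  unfolding is_kernel_def
proof (intro conjI ballI impI)
  interpret M: preadditive_category "Mod_cat C :: (('o, 'm, 'u) modl, _) addcat" by (rule Mod_preadditive)
  show "Cmp (Mod_cat C) I Y K j q = ZeroM (Mod_cat C) I K"
    using ex nat_closed[OF j] by (simp add: Cmp_eq_zero_iff)
  fix W :: "('o, 'm, 'u) modl" and u
  assume W: "W \<in> Ob (Mod_cat C)" and u: "u \<in> Hom (Mod_cat C) W Y"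
    and "Cmp (Mod_cat C) W Y K u q = ZeroM (Mod_cat C) W K"
  then have zero: "q T (u T x) = \<one>\<^bsub>FOb K T\<^esub>" if "T \<in> Ob C" "x \<in> carrier (FOb W T)" for T x
    using that by (simp add: Cmp_eq_zero_iff)
  \<comment> \<open>The unique preimage under \<open>j\<close>. Since \<open>j\<close> is injective,
    additivity and naturality of \<open>h\<close> may be tested after applying \<open>j\<close>,
    where they are those of \<open>u\<close>.\<close>
  define h where "h T x = inv_into (carrier (FOb I T)) (j T) (u T x)" for T x
  have h: "h T x \<in> carrier (FOb I T)" "j T (h T x) = u T x"
    if T: "T \<in> Ob C" and x: "x \<in> carrier (FOb W T)" for T x
  proof -
    have *: "u T x \<in> j T ` carrier (FOb I T)"
      using ex[OF T nat_closed[OF u T x]] zero[OF T x] by simp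
    show "h T x \<in> carrier (FOb I T)" unfolding h_def by (rule inv_into_into[OF *])
    show "j T (h T x) = u T x" unfolding h_def by (rule f_inv_into_f[OF *])
  qed
  let ?s = "\<lambda>T \<in> Ob C. restrict (h T) (carrier (FOb W T))"
  have s: "?s \<in> Hom (Mod_cat C) W I"
  proof (rule Mod_HomI[OF _ _ W])
    fix T assume T: "T \<in> Ob C"
    interpret u: group_hom "FOb W T" "FOb Y T" "u T" by (rule nat_group_hom[OF W Y u T])
    interpret j: group_hom "FOb I T" "FOb Y T" "j T" by (rule nat_group_hom[OF I Y j T])
    show "h T \<in> hom (FOb W T) (FOb I T)"
    proof (rule homI)
      fix x y assume xy: "x \<in> carrier (FOb W T)" "y \<in> carrier (FOb W T)"
      show "h T (x \<otimes>\<^bsub>FOb W T\<^esub> y) = h T x \<otimes>\<^bsub>FOb I T\<^esub> h T y"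
        by (rule inj_onD[OF inj[OF T]]) (simp_all add: h[OF T] xy)
    qed (rule h(1)[OF T])
  next
    fix S T f x assume S: "S \<in> Ob C" and T: "T \<in> Ob C" and f: "f \<in> Hom C T S"
      and x: "x \<in> carrier (FOb W S)"
    show "h T (FMor W S T f x) = FMor I S T f (h S x)"
      by (rule inj_onD[OF inj[OF T]])
        (simp_all add: h[OF T act_closed[OF W S T f x]] h[OF S x] nat_act[OF u S T f x]
          nat_act[OF j S T f h(1)[OF S x]] act_closed[OF I S T f h(1)[OF S x]])
  qed
  show "\<exists>!s. s \<in> Hom (Mod_cat C) W I \<and> Cmp (Mod_cat C) W I Y s j = u"
  proof (rule ex1I[of _ ?s])
    have "Cmp (Mod_cat C) W I Y ?s j = u"
      by (rule Mod_hom_eqI[OF M.cmp_closed[OF W I Y s j] u]) (simp add: Mod_Cmp_apply h)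
    then show "?s \<in> Hom (Mod_cat C) W I \<and> Cmp (Mod_cat C) W I Y ?s j = u" using s by blast
  next
    fix s' assume "s' \<in> Hom (Mod_cat C) W I \<and> Cmp (Mod_cat C) W I Y s' j = u"
    then have s': "s' \<in> Hom (Mod_cat C) W I" and eq: "Cmp (Mod_cat C) W I Y s' j = u" by auto
    show "s' = ?s"
    proof (rule Mod_hom_eqI[OF s' s])
      fix T x assume T: "T \<in> Ob C" and x: "x \<in> carrier (FOb W T)"
      have "j T (s' T x) = j T (h T x)"
        using Mod_Cmp_apply[OF T x, where \<eta> = s' and \<theta> = j and G = I and H = Y] h(2)[OF T x]
        by (simp add: eq)
      then show "s' T x = ?s T x"
        using inj_onD[OF inj[OF T]] nat_closed[OF s' T x] h(1)[OF T x] T x by simp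
    qed
  qed
qed fact+

text \<open>The image of \<open>f\<close> is generated by \<open>f x\<close>, so it is determined by the annihilator of \<open>f x\<close>.\<close>

lemma is_imageI:
  fixes X Y I K :: "('o, 'm, 'u) modl"
  assumes X: "X \<in> Ob (Mod_cat C)" and Y: "Y \<in> Ob (Mod_cat C)" and I: "I \<in> Ob (Mod_cat C)"
    and f: "f \<in> Hom (Mod_cat C) X Y" and gX: "generates X A x" and gI: "generates I A z"
    and ann: "\<And>T \<sigma>. \<lbrakk>T \<in> Ob C; \<sigma> \<in> Hom C T A\<rbrakk>
      \<Longrightarrow> FMor I A T \<sigma> z = \<one>\<^bsub>FOb I T\<^esub> \<longleftrightarrow> f T (FMor X A T \<sigma> x) = \<one>\<^bsub>FOb Y T\<^esub>"
    and K: "is_cokernel (Mod_cat C) X Y f K q"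
    and ex: "\<And>T b. \<lbrakk>T \<in> Ob C; b \<in> carrier (FOb Y T)\<rbrakk>
      \<Longrightarrow> q T b = \<one>\<^bsub>FOb K T\<^esub> \<longleftrightarrow> b \<in> f T ` carrier (FOb X T)"
  shows "\<exists>j. is_kernel (Mod_cat C) Y K q I j"
proof -
  have A: "A \<in> Ob C" and x: "x \<in> carrier (FOb X A)" and z: "z \<in> carrier (FOb I A)"
    using gX gI by (auto simp: generates_def)
  have fx: "FMor Y A T \<sigma> (f A x) = f T (FMor X A T \<sigma> x)" if "T \<in> Ob C" "\<sigma> \<in> Hom C T A" for T \<sigma>
    using nat_act[OF f A that x] by simp
  obtain j where j: "j \<in> Hom (Mod_cat C) I Y" "j A z = f A x"
    using ex_hom_from_generated[OF I Y gI nat_closed[OF f A x]] ann fx by auto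
  have jz: "j T (FMor I A T \<sigma> z) = f T (FMor X A T \<sigma> x)" if "T \<in> Ob C" "\<sigma> \<in> Hom C T A" for T \<sigma>
    using nat_act[OF j(1) A that z] fx[OF that] j(2) by simp
  have im: "j T ` carrier (FOb I T) = f T ` carrier (FOb X T)" if T: "T \<in> Ob C" for T
    unfolding generates_carrier[OF I gI T] generates_carrier[OF X gX T] image_image
    by (rule image_cong) (simp_all add: jz[OF T])
  have inj: "inj_on (j T) (carrier (FOb I T))" if T: "T \<in> Ob C" for T
  proof -
    interpret group_hom "FOb I T" "FOb Y T" "j T" by (rule nat_group_hom[OF I Y j(1) T])
    \<comment> \<open>One direction of \<open>ann\<close> made \<open>j\<close> well defined; the
      other one makes it injective. With \<open>a = \<sigma> z\<close>, the assumption says that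
      \<open>f\<close> kills \<open>\<sigma> x\<close>, so \<open>\<sigma>\<close> annihilates
      \<open>z\<close>.\<close>
    have "a = \<one>\<^bsub>FOb I T\<^esub>" if "a \<in> carrier (FOb I T)" "j T a = \<one>\<^bsub>FOb Y T\<^esub>" for a
      using that ann[OF T] jz[OF T] unfolding generates_carrier[OF I gI T] by auto
    then show ?thesis by (subst inj_on_one_iff) auto
  qed
  have "q \<in> Hom (Mod_cat C) Y K" using K by (simp add: is_cokernel_def)
  then have "is_kernel (Mod_cat C) Y K q I j"
    by (rule is_kernelI[OF I Y _ j(1) inj]) (simp_all add: ex im)
  then show ?thesis by blast
qed

end

section \<open>Modules presented by cospans\<close>

lemma copy_group_carrier [simp]: "carrier (copy_group j G) = j ` carrier G"
  by (simp add: copy_group_def)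

lemma copy_group_mult: "inj j \<Longrightarrow> j x \<otimes>\<^bsub>copy_group j G\<^esub> j y = j (x \<otimes>\<^bsub>G\<^esub> y)"
  by (simp add: copy_group_def)

lemma copy_group_one [simp]: "\<one>\<^bsub>copy_group j G\<^esub> = j \<one>\<^bsub>G\<^esub>"
  by (simp add: copy_group_def)

lemma copy_map_apply: "\<lbrakk>inj j; x \<in> A\<rbrakk> \<Longrightarrow> copy_map j k A f (j x) = k (f x)"
  by (simp add: copy_map_def)

lemma comm_group_copy_group:
  assumes "inj j" "comm_group G"
  shows "comm_group (copy_group j G)"
proof -
  interpret G: comm_group G by fact
  show ?thesis
  proof (rule comm_groupI)
    fix x assume "x \<in> carrier (copy_group j G)"
    then obtain a where a: "a \<in> carrier G" "x = j a" by auto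
    then have "j (inv\<^bsub>G\<^esub> a) \<otimes>\<^bsub>copy_group j G\<^esub> x = \<one>\<^bsub>copy_group j G\<^esub>"
      by (simp add: copy_group_mult[OF assms(1)])
    moreover have "j (inv\<^bsub>G\<^esub> a) \<in> carrier (copy_group j G)" using a by simp
    ultimately show "\<exists>y\<in>carrier (copy_group j G). y \<otimes>\<^bsub>copy_group j G\<^esub> x = \<one>\<^bsub>copy_group j G\<^esub>"
      by blast
  qed (auto simp: copy_group_mult[OF assms(1)] G.m_ac)
qed

lemma comm_group_subgroup:
  assumes "comm_group G" "subgroup H G"
  shows "comm_group (G\<lparr>carrier := H\<rparr>)"
proof -
  interpret comm_group G by fact
  show ?thesis
    by (rule group.group_comm_groupI[OF subgroup.subgroup_is_group[OF assms(2) is_group]])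
      (use subgroup.subset[OF assms(2)] m_comm in auto)
qed

context preadditive_category
begin

text \<open>Both \<open>yoneda_obj\<close> and \<open>Mbar_obj\<close> have this shape. The module
  axioms can thus be verified on the original groups \<open>G T\<close>, with the transport along
  \<open>j\<close> dealt with once.\<close>

lemma copy_module:
  assumes j: "inj j"
    and grp: "\<And>T. T \<in> Ob C \<Longrightarrow> comm_group (G T)"
    and hom: "\<And>S T f. \<lbrakk>S \<in> Ob C; T \<in> Ob C; f \<in> Hom C T S\<rbrakk> \<Longrightarrow> \<phi> S T f \<in> hom (G S) (G T)"
    and add: "\<And>S T f g x. \<lbrakk>S \<in> Ob C; T \<in> Ob C; f \<in> Hom C T S; g \<in> Hom C T S; x \<in> carrier (G S)\<rbrakk>
      \<Longrightarrow> \<phi> S T (f \<otimes>\<^bsub>HomG C T S\<^esub> g) x = \<phi> S T f x \<otimes>\<^bsub>G T\<^esub> \<phi> S T g x"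
    and idt: "\<And>T x. \<lbrakk>T \<in> Ob C; x \<in> carrier (G T)\<rbrakk> \<Longrightarrow> \<phi> T T (Idt C T) x = x"
    and cmp: "\<And>S T U f g x. \<lbrakk>S \<in> Ob C; T \<in> Ob C; U \<in> Ob C; f \<in> Hom C T S; g \<in> Hom C U T;
      x \<in> carrier (G S)\<rbrakk> \<Longrightarrow> \<phi> S U (Cmp C U T S g f) x = \<phi> T U g (\<phi> S T f x)"
  shows "\<lparr>FOb = \<lambda>T. copy_group j (G T),
      FMor = \<lambda>S T f. copy_map j j (carrier (G S)) (\<phi> S T f)\<rparr> \<in> Ob (Mod_cat C)"
    (is "?W \<in> _")
proof -
  have m: "copy_map j j (carrier (G S)) (\<phi> S T f) (j x) = j (\<phi> S T f x)"
    if "x \<in> carrier (G S)" for S T f x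
    by (rule copy_map_apply[OF j that])
  have closed: "\<phi> S T f x \<in> carrier (G T)"
    if "S \<in> Ob C" "T \<in> Ob C" "f \<in> Hom C T S" "x \<in> carrier (G S)" for S T f x
    using hom_in_carrier[OF hom[OF that(1-3)] that(4)] .
  have "copy_map j j (carrier (G S)) (\<phi> S T f) \<in> hom (copy_group j (G S)) (copy_group j (G T))"
    if "S \<in> Ob C" "T \<in> Ob C" "f \<in> Hom C T S" for S T f
  proof (rule homI)
    interpret S: comm_group "G S" by (rule grp[OF that(1)])
    fix x assume "x \<in> carrier (copy_group j (G S))"
    then obtain a where a: "x = j a" "a \<in> carrier (G S)" by auto
    then show "copy_map j j (carrier (G S)) (\<phi> S T f) x \<in> carrier (copy_group j (G T))"
      by (simp add: m closed that)
    fix y assume "y \<in> carrier (copy_group j (G S))"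
    then obtain b where b: "y = j b" "b \<in> carrier (G S)" by auto
    show "copy_map j j (carrier (G S)) (\<phi> S T f) (x \<otimes>\<^bsub>copy_group j (G S)\<^esub> y)
      = copy_map j j (carrier (G S)) (\<phi> S T f) x
        \<otimes>\<^bsub>copy_group j (G T)\<^esub> copy_map j j (carrier (G S)) (\<phi> S T f) y"
      by (simp add: a b m copy_group_mult[OF j] hom_mult[OF hom[OF that]])
  qed
  then show ?thesis
    unfolding mem_Ob_Mod
    by (auto simp: m closed add idt cmp copy_group_mult[OF j] comm_group_copy_group[OF j grp])
      (auto simp: copy_map_def)
qed

text \<open>The map from the representable functor of \<open>Src X\<close> to \<open>W\<close> given
  by \<open>w\<close> is surjective, and its kernel at \<open>T\<close> consists of the syzygies
  with source \<open>T\<close>. This fixes \<open>W\<close> up to isomorphism whatever the elements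
  of its carriers are.\<close>

definition presents :: "('o, 'm) cospan \<Rightarrow> ('o, 'm, 'u) modl \<Rightarrow> 'u \<Rightarrow> bool" where
  "presents X W w \<longleftrightarrow> generates W (Src X) w \<and>
    (\<forall>T \<in> Ob C. \<forall>\<sigma> \<in> Hom C T (Src X). FMor W (Src X) T \<sigma> w = \<one>\<^bsub>FOb W T\<^esub> \<longleftrightarrow> (T, \<sigma>) \<in> Syz C X)"

section \<open>Representable functors as presented modules\<close>

lemma yoneda_obj_Mod:
  fixes e :: "'m set \<Rightarrow> 'u"
  assumes e: "inj e" and A: "A \<in> Ob C"
  shows "yoneda_obj e C A \<in> Ob (Mod_cat C)"
  unfolding yoneda_obj_def
proof (rule copy_module)
  show "inj (single e)" using e by (auto simp: single_def inj_def)
  show "Cmp C T S A f \<in> hom (HomG C S A) (HomG C T A)"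
    if "S \<in> Ob C" "T \<in> Ob C" "f \<in> Hom C T S" for S T f
    using group_hom.homh[OF cmp_hom_right[OF that(2,1) A that(3)]] .
qed (simp_all add: A hom_group cmp_add_left idt_left cmp_assoc)

lemma yoneda_obj_act:
  assumes "inj e" "S \<in> Ob C" "f \<in> Hom C S A"
  shows "FMor (yoneda_obj e C A) S T \<sigma> (single e f) = single e (Cmp C T S A \<sigma> f)"
proof -
  have "inj (single e)" using assms(1) by (auto simp: single_def inj_def)
  then show ?thesis by (simp add: yoneda_obj_def copy_map_apply assms)
qed

lemma yoneda_obj_one: "\<one>\<^bsub>FOb (yoneda_obj e C A) T\<^esub> = single e (ZeroM C T A)"
  by (simp add: yoneda_obj_def)

lemma mem_yoneda_obj: "x \<in> carrier (FOb (yoneda_obj e C A) T) \<longleftrightarrow> x \<in> single e ` Hom C T A"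
  by (simp add: yoneda_obj_def)

lemma generates_yoneda_obj:
  assumes "inj e" "A \<in> Ob C"
  shows "generates (yoneda_obj e C A) A (single e (Idt C A))"
  unfolding generates_def using assms
  by (auto simp: mem_yoneda_obj yoneda_obj_act idt_closed idt_right)

text \<open>With the identity as \<open>gam\<close> and zero as \<open>rho\<close>, only zero
  morphisms are syzygies, which is the annihilator of the identity. A zero morphism from any object
  would serve as \<open>rho\<close>; \<open>A\<close> is at hand.\<close>

lemma presents_yoneda_obj:
  assumes "inj e" "A \<in> Ob C"
  shows "presents \<lparr>Src = A, Mid = A, Rel = A, gam = Idt C A, rho = ZeroM C A A\<rparr>
    (yoneda_obj e C A) (single e (Idt C A))"
proof -
  have inj: "single e x = single e y \<longleftrightarrow> x = y" for x y
    using assms(1) by (simp add: single_def inj_eq)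
  show ?thesis
    unfolding presents_def using assms generates_yoneda_obj[OF assms]
    by (auto simp: yoneda_obj_act yoneda_obj_one idt_closed idt_right Syz_def cmp_zero_right inj
      zero_closed)
qed

section \<open>The subquotient attached to a fixed cospan\<close>

context
  fixes X :: "('o, 'm) cospan"
  assumes X: "X \<in> cospans C"
begin

lemma cospanD:
  "Src X \<in> Ob C" "Mid X \<in> Ob C" "Rel X \<in> Ob C"
  "gam X \<in> Hom C (Src X) (Mid X)" "rho X \<in> Hom C (Rel X) (Mid X)"
  using X by (auto simp: cospans_def)

lemma mem_im_at: "x \<in> im_at C A B f T \<longleftrightarrow> (\<exists>a \<in> Hom C T A. x = Cmp C T A B a f)"
  by (auto simp: im_at_def)

lemma im_at_subgroup:
  "\<lbrakk>A \<in> Ob C; B \<in> Ob C; T \<in> Ob C; f \<in> Hom C A B\<rbrakk> \<Longrightarrow> subgroup (im_at C A B f T) (HomG C T B)"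
  unfolding im_at_def by (rule group_hom.img_is_subgroup[OF cmp_hom_left])

text \<open>Precomposing \<open>a f\<close> with \<open>g\<close> gives \<open>(g a) f\<close>, so
  the image of \<open>(-, f)\<close> is a submodule of \<open>(-, B)\<close>.\<close>

lemma im_at_act:
  "\<lbrakk>A \<in> Ob C; B \<in> Ob C; S \<in> Ob C; T \<in> Ob C; f \<in> Hom C A B; g \<in> Hom C T S; x \<in> im_at C A B f S\<rbrakk>
    \<Longrightarrow> Cmp C T S B g x \<in> im_at C A B f T"
  using cmp_closed[of T S A g] cmp_assoc[of T S A B g _ f] unfolding mem_im_at by metis

lemma im_gam_comm_group: "T \<in> Ob C \<Longrightarrow> comm_group (im_gam C X T)"
  unfolding im_gam_def
  by (rule comm_group_subgroup[OF hom_group[OF _ cospanD(2)] im_at_subgroup[OF cospanD(1,2) _ cospanD(4)]])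

lemma im_cap_subgroup: "T \<in> Ob C \<Longrightarrow> subgroup (im_cap C X T) (im_gam C X T)"
  unfolding im_gam_def im_cap_def
  using group.subgroup_incl[OF hom_grp[OF _ cospanD(2)]
      group.subgroups_Inter_pair[OF hom_grp[OF _ cospanD(2)]
        im_at_subgroup[OF cospanD(3,2) _ cospanD(5)] im_at_subgroup[OF cospanD(1,2) _ cospanD(4)]]
      im_at_subgroup[OF cospanD(1,2) _ cospanD(4)]] by blast

lemma im_cap_normal: "T \<in> Ob C \<Longrightarrow> im_cap C X T \<lhd> im_gam C X T"
  by (rule comm_group.subgroup_imp_normal[OF im_gam_comm_group im_cap_subgroup])

definition coset_at :: "'o \<Rightarrow> 'm \<Rightarrow> 'm set" where
  "coset_at T y = im_cap C X T #>\<^bsub>im_gam C X T\<^esub> y"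

lemma coset_at_group_hom:
  assumes T: "T \<in> Ob C"
  shows "group_hom (im_gam C X T) (im_gam C X T Mod im_cap C X T) (coset_at T)"
proof (intro group_hom.intro group_hom_axioms.intro)
  interpret normal "im_cap C X T" "im_gam C X T" by (rule im_cap_normal[OF T])
  show "group (im_gam C X T)" by (rule is_group)
  show "group (im_gam C X T Mod im_cap C X T)" by (rule factorgroup_is_group)
  show "coset_at T \<in> hom (im_gam C X T) (im_gam C X T Mod im_cap C X T)"
    using r_coset_hom_Mod unfolding coset_at_def[abs_def] .
qed

lemma coset_at_eq_one_iff:
  assumes T: "T \<in> Ob C" and y: "y \<in> carrier (im_gam C X T)"
  shows "coset_at T y = \<one>\<^bsub>im_gam C X T Mod im_cap C X T\<^esub> \<longleftrightarrow> y \<in> im_cap C X T"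
proof -
  interpret group "im_gam C X T" using im_gam_comm_group[OF T] by (rule comm_group.axioms(2))
  note s = im_cap_subgroup[OF T]
  show ?thesis
    using coset_join1[OF _ y s] coset_join2[OF y s] by (auto simp: coset_at_def FactGroup_def)
qed

lemma FactGroup_eq_coset_at:
  "carrier (im_gam C X T Mod im_cap C X T) = coset_at T ` carrier (im_gam C X T)"
  by (auto simp: FactGroup_def RCOSETS_def coset_at_def)

lemma im_gam_carrier: "carrier (im_gam C X T) = im_at C (Src X) (Mid X) (gam X) T"
  by (simp add: im_gam_def)

lemma im_gam_act_hom:
  assumes "S \<in> Ob C" "T \<in> Ob C" "f \<in> Hom C T S"
  shows "Cmp C T S (Mid X) f \<in> hom (im_gam C X S) (im_gam C X T)"
proof (rule homI)
  note sub = subgroup.subset[OF im_at_subgroup[OF cospanD(1,2) assms(1) cospanD(4)]]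
  fix x assume x: "x \<in> carrier (im_gam C X S)"
  show "Cmp C T S (Mid X) f x \<in> carrier (im_gam C X T)"
    using im_at_act[OF cospanD(1,2) assms(1,2) cospanD(4) assms(3)] x by (simp add: im_gam_carrier)
  fix y assume "y \<in> carrier (im_gam C X S)"
  then show "Cmp C T S (Mid X) f (x \<otimes>\<^bsub>im_gam C X S\<^esub> y)
    = Cmp C T S (Mid X) f x \<otimes>\<^bsub>im_gam C X T\<^esub> Cmp C T S (Mid X) f y"
    using x sub cmp_add_right[OF assms(2,1) cospanD(2) assms(3)] by (auto simp: im_gam_def)
qed

abbreviation act_coset :: "'o \<Rightarrow> 'o \<Rightarrow> 'm \<Rightarrow> 'm set \<Rightarrow> 'm set" where
  "act_coset S T f c \<equiv> \<Union>x \<in> c. coset_at T (Cmp C T S (Mid X) f x)"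

text \<open>Elements of one coset differ by some \<open>k\<close> in \<open>im_cap\<close>. Both
  images are closed under the action, so \<open>f\<close> sends \<open>k\<close> into
  \<open>im_cap\<close> again and all cosets in the union coincide. Since \<open>y\<close> lies in
  its own coset, the union is not empty and equals the common coset.\<close>

lemma act_coset_at:
  assumes S: "S \<in> Ob C" and T: "T \<in> Ob C" and f: "f \<in> Hom C T S" and y: "y \<in> carrier (im_gam C X S)"
  shows "act_coset S T f (coset_at S y) = coset_at T (Cmp C T S (Mid X) f y)"
proof -
  interpret S: comm_group "im_gam C X S" by (rule im_gam_comm_group[OF S])
  interpret c: group_hom "im_gam C X T" "im_gam C X T Mod im_cap C X T" "coset_at T"
    by (rule coset_at_group_hom[OF T])
  interpret f: group_hom "im_gam C X S" "im_gam C X T" "Cmp C T S (Mid X) f"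
    by (intro group_hom.intro group_hom_axioms.intro im_gam_act_hom S T f S.is_group c.G.is_group)
  note sub = im_cap_subgroup[OF S]
  have "coset_at T (Cmp C T S (Mid X) f x) = coset_at T (Cmp C T S (Mid X) f y)"
    if x: "x \<in> coset_at S y" for x
  proof -
    obtain k where k: "k \<in> im_cap C X S" "x = k \<otimes>\<^bsub>im_gam C X S\<^esub> y"
      using x by (auto simp: coset_at_def r_coset_def)
    have kS: "k \<in> carrier (im_gam C X S)" using subgroup.subset[OF sub] k by blast
    have "Cmp C T S (Mid X) f k \<in> im_cap C X T"
      using k(1) im_at_act[OF cospanD(1,2) S T cospanD(4) f] im_at_act[OF cospanD(3,2) S T cospanD(5) f]
      by (simp add: im_cap_def)
    then have "coset_at T (Cmp C T S (Mid X) f k) = \<one>\<^bsub>im_gam C X T Mod im_cap C X T\<^esub>"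
      using coset_at_eq_one_iff[OF T f.hom_closed[OF kS]] by simp
    then show ?thesis
      using c.hom_mult[OF f.hom_closed[OF kS] f.hom_closed[OF y]]
        c.H.l_one[OF c.hom_closed[OF f.hom_closed[OF y]]] kS y
      by (simp add: k(2) del: one_FactGroup mult_FactGroup)
  qed
  moreover have "y \<in> coset_at S y"
    unfolding coset_at_def by (rule S.rcos_self[OF y sub])
  ultimately show ?thesis by blast
qed

lemma Mbar_obj_eq:
  "Mbar_obj e C X = \<lparr>FOb = \<lambda>T. copy_group e (im_gam C X T Mod im_cap C X T),
    FMor = \<lambda>S T f. copy_map e e (carrier (im_gam C X S Mod im_cap C X S)) (act_coset S T f)\<rparr>"
  by (simp add: Mbar_obj_def coset_at_def)

text \<open>Every element is a class \<open>coset_at T x\<close>, and \<open>coset_at\<close> is a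
  homomorphism compatible with the action. Hence each axiom descends from precomposition on the
  image of \<open>(-, gam X)\<close>.\<close>

lemma Mbar_obj_Mod:
  fixes e :: "'m set \<Rightarrow> 'u"
  assumes e: "inj e"
  shows "Mbar_obj e C X \<in> Ob (Mod_cat C)"
  unfolding Mbar_obj_eq
proof (rule copy_module[OF e])
  note sub = subgroup.subset[OF im_at_subgroup[OF cospanD(1,2) _ cospanD(4)], THEN subsetD,
    folded im_gam_carrier]
  note coset_mult = group_hom.hom_mult[OF coset_at_group_hom]
    and coset_closed = group_hom.hom_closed[OF coset_at_group_hom]
    and act = hom_in_carrier[OF im_gam_act_hom] hom_mult[OF im_gam_act_hom]
  note im_gam_closed = group.is_monoid[OF comm_group.axioms(2)[OF im_gam_comm_group], THEN monoid.m_closed]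
  show "comm_group (im_gam C X T Mod im_cap C X T)" if "T \<in> Ob C" for T
    using comm_group.abelian_FactGroup[OF im_gam_comm_group im_cap_subgroup] that by blast
  show "act_coset S T f \<in> hom (im_gam C X S Mod im_cap C X S) (im_gam C X T Mod im_cap C X T)"
    if that: "S \<in> Ob C" "T \<in> Ob C" "f \<in> Hom C T S" for S T f
  proof (rule homI)
    fix c assume "c \<in> carrier (im_gam C X S Mod im_cap C X S)"
    then obtain x where x: "x \<in> carrier (im_gam C X S)" "c = coset_at S x"
      by (auto simp: FactGroup_eq_coset_at)
    then show "act_coset S T f c \<in> carrier (im_gam C X T Mod im_cap C X T)"
      using that by (simp add: act_coset_at act coset_closed)
    fix d assume "d \<in> carrier (im_gam C X S Mod im_cap C X S)"
    then obtain y where y: "y \<in> carrier (im_gam C X S)" "d = coset_at S y"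
      by (auto simp: FactGroup_eq_coset_at)
    show "act_coset S T f (c \<otimes>\<^bsub>im_gam C X S Mod im_cap C X S\<^esub> d)
      = act_coset S T f c \<otimes>\<^bsub>im_gam C X T Mod im_cap C X T\<^esub> act_coset S T f d"
    proof -
      have "act_coset S T f (c \<otimes>\<^bsub>im_gam C X S Mod im_cap C X S\<^esub> d)
          = coset_at T (Cmp C T S (Mid X) f (x \<otimes>\<^bsub>im_gam C X S\<^esub> y))"
        unfolding x(2) y(2) coset_mult[OF that(1) x(1) y(1), symmetric]
        by (rule act_coset_at[OF that im_gam_closed[OF that(1) x(1) y(1)]])
      also have "\<dots> = act_coset S T f c \<otimes>\<^bsub>im_gam C X T Mod im_cap C X T\<^esub> act_coset S T f d"
        unfolding x(2) y(2) act_coset_at[OF that x(1)] act_coset_at[OF that y(1)]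
          act(2)[OF that x(1) y(1)]
        by (rule coset_mult[OF that(2) act(1)[OF that x(1)] act(1)[OF that y(1)]])
      finally show ?thesis .
    qed
  qed
  show "act_coset S T (f \<otimes>\<^bsub>HomG C T S\<^esub> g) c
      = act_coset S T f c \<otimes>\<^bsub>im_gam C X T Mod im_cap C X T\<^esub> act_coset S T g c"
    if "S \<in> Ob C" "T \<in> Ob C" "f \<in> Hom C T S" "g \<in> Hom C T S"
      and c: "c \<in> carrier (im_gam C X S Mod im_cap C X S)" for S T f g c
  proof -
    obtain x where x: "x \<in> carrier (im_gam C X S)" "c = coset_at S x"
      using c by (auto simp: FactGroup_eq_coset_at)
    have "Cmp C T S (Mid X) (f \<otimes>\<^bsub>HomG C T S\<^esub> g) x
      = Cmp C T S (Mid X) f x \<otimes>\<^bsub>im_gam C X T\<^esub> Cmp C T S (Mid X) g x"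
      using that x sub cmp_add_left[OF that(2,1) cospanD(2) that(3,4)] by (simp add: im_gam_def)
    then show ?thesis
      using that x(1) add_closed[OF that(2,1,3,4)]
      by (simp add: x(2) act_coset_at act coset_mult[symmetric] del: mult_FactGroup)
  qed
  show "act_coset T T (Idt C T) c = c"
    if T: "T \<in> Ob C" and c: "c \<in> carrier (im_gam C X T Mod im_cap C X T)" for T c
  proof -
    obtain x where x: "x \<in> carrier (im_gam C X T)" "c = coset_at T x"
      using c by (auto simp: FactGroup_eq_coset_at)
    then show ?thesis
      using T sub[OF T] by (simp add: act_coset_at idt_closed idt_left cospanD)
  qed
  show "act_coset S U (Cmp C U T S g f) c = act_coset T U g (act_coset S T f c)"
    if "S \<in> Ob C" "T \<in> Ob C" "U \<in> Ob C" "f \<in> Hom C T S" "g \<in> Hom C U T"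
      and c: "c \<in> carrier (im_gam C X S Mod im_cap C X S)" for S T U f g c
  proof -
    obtain x where x: "x \<in> carrier (im_gam C X S)" "c = coset_at S x"
      using c by (auto simp: FactGroup_eq_coset_at)
    then show ?thesis
      using that(1-5) sub[OF that(1)]
      by (simp add: act_coset_at act cmp_closed cmp_assoc cospanD)
  qed
qed

text \<open>The generator is the class of \<open>gam X\<close> itself, the value of the natural
  epimorphism at the identity. Acting with \<open>\<sigma>\<close> gives the class of
  \<open>\<sigma> \<gamma>\<close>. As this element lies in the image of \<open>\<gamma>\<close>
  anyway, its class vanishes exactly if it factors through \<open>\<rho>\<close>, that is, if
  \<open>\<sigma>\<close> is a syzygy.\<close>

lemma presents_Mbar_obj:
  assumes e: "inj e"
  shows "presents X (Mbar_obj e C X) (e (coset_at (Src X) (gam X)))"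
proof -
  note D = cospanD
  have \<gamma>: "gam X \<in> carrier (im_gam C X (Src X))"
    unfolding im_gam_carrier mem_im_at using idt_closed[OF D(1)] idt_left[OF D(1,2,4)] by metis
  have act: "FMor (Mbar_obj e C X) (Src X) T \<sigma> (e (coset_at (Src X) (gam X)))
      = e (coset_at T (Cmp C T (Src X) (Mid X) \<sigma> (gam X)))"
    if "T \<in> Ob C" "\<sigma> \<in> Hom C T (Src X)" for T \<sigma>
    using that D(1) \<gamma>
    by (simp add: Mbar_obj_eq copy_map_apply[OF e] act_coset_at FactGroup_eq_coset_at)
  have "generates (Mbar_obj e C X) (Src X) (e (coset_at (Src X) (gam X)))"
    unfolding generates_def
  proof (intro conjI ballI)
    show "e (coset_at (Src X) (gam X)) \<in> carrier (FOb (Mbar_obj e C X) (Src X))"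
      using \<gamma> by (simp add: Mbar_obj_eq FactGroup_eq_coset_at)
    fix T x assume T: "T \<in> Ob C" and "x \<in> carrier (FOb (Mbar_obj e C X) T)"
    then obtain \<sigma> where "\<sigma> \<in> Hom C T (Src X)" "x = e (coset_at T (Cmp C T (Src X) (Mid X) \<sigma> (gam X)))"
      by (auto simp: Mbar_obj_eq FactGroup_eq_coset_at im_gam_carrier mem_im_at)
    then show "\<exists>\<sigma>\<in>Hom C T (Src X).
        x = FMor (Mbar_obj e C X) (Src X) T \<sigma> (e (coset_at (Src X) (gam X)))"
      using act[OF T] by auto
  qed (rule D(1))
  moreover have "FMor (Mbar_obj e C X) (Src X) T \<sigma> (e (coset_at (Src X) (gam X)))
      = \<one>\<^bsub>FOb (Mbar_obj e C X) T\<^esub> \<longleftrightarrow> (T, \<sigma>) \<in> Syz C X"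
    if T: "T \<in> Ob C" and \<sigma>: "\<sigma> \<in> Hom C T (Src X)" for T \<sigma>
  proof -
    have im: "Cmp C T (Src X) (Mid X) \<sigma> (gam X) \<in> carrier (im_gam C X T)"
      using \<sigma> by (auto simp: im_gam_carrier mem_im_at)
    have "FMor (Mbar_obj e C X) (Src X) T \<sigma> (e (coset_at (Src X) (gam X)))
        = \<one>\<^bsub>FOb (Mbar_obj e C X) T\<^esub>
      \<longleftrightarrow> Cmp C T (Src X) (Mid X) \<sigma> (gam X) \<in> im_cap C X T"
      unfolding act[OF T \<sigma>] coset_at_eq_one_iff[OF T im, symmetric]
      by (simp add: Mbar_obj_eq inj_eq[OF e])
    also have "\<dots> \<longleftrightarrow> (T, \<sigma>) \<in> Syz C X"
      using im T \<sigma> by (simp add: im_cap_def im_gam_carrier mem_im_at Syz_def)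
    finally show ?thesis .
  qed
  ultimately show ?thesis by (simp add: presents_def)
qed

end

end

section \<open>Closure properties of presentable modules\<close>

context preadditive_category
begin

section \<open>Biproducts and full subcategories\<close>

text \<open>The sum \<open>f i + g j\<close> has the prescribed components because the cross terms
  vanish.\<close>

lemma biproduct_pair:
  assumes B: "is_biproduct C X Y B i j p q" and Ob: "X \<in> Ob C" "Y \<in> Ob C" "T \<in> Ob C"
    and f: "f \<in> Hom C T X" and g: "g \<in> Hom C T Y"
  obtains h where "h \<in> Hom C T B" "Cmp C T B X h p = f" "Cmp C T B Y h q = g"
proof
  note D = B[unfolded is_biproduct_def]
  let ?h = "Cmp C T X B f i \<otimes>\<^bsub>HomG C T B\<^esub> Cmp C T Y B g j"
  show "?h \<in> Hom C T B" using D Ob f g by (intro add_closed cmp_closed) auto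
  interpret X: group "HomG C T X" by (rule hom_grp[OF Ob(3,1)])
  interpret Y: group "HomG C T Y" by (rule hom_grp[OF Ob(3,2)])
  show "Cmp C T B X ?h p = f"
    using D Ob f g by (simp add: cmp_add_left cmp_closed cmp_assoc idt_right cmp_zero_right)
  show "Cmp C T B Y ?h q = g"
    using D Ob f g by (simp add: cmp_add_left cmp_closed cmp_assoc idt_right cmp_zero_right)
qed

text \<open>Expanding \<open>h = h (p i + q j)\<close> recovers a morphism from its two
  components.\<close>

lemma biproduct_eqI:
  assumes B: "is_biproduct C X Y B i j p q" and Ob: "X \<in> Ob C" "Y \<in> Ob C" "T \<in> Ob C"
    and h: "h \<in> Hom C T B" "h' \<in> Hom C T B"
    and eq: "Cmp C T B X h p = Cmp C T B X h' p" "Cmp C T B Y h q = Cmp C T B Y h' q"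
  shows "h = h'"
proof -
  note D = B[unfolded is_biproduct_def]
  have "k = Cmp C T X B (Cmp C T B X k p) i \<otimes>\<^bsub>HomG C T B\<^esub> Cmp C T Y B (Cmp C T B Y k q) j"
    if k: "k \<in> Hom C T B" for k
  proof -
    have "k = Cmp C T B B k (Cmp C B X B p i \<otimes>\<^bsub>HomG C B B\<^esub> Cmp C B Y B q j)"
      using D Ob k by (simp add: idt_right)
    also have "\<dots> = Cmp C T B B k (Cmp C B X B p i) \<otimes>\<^bsub>HomG C T B\<^esub> Cmp C T B B k (Cmp C B Y B q j)"
      using D Ob k by (intro cmp_add_right cmp_closed) auto
    finally show ?thesis using D Ob k by (simp add: cmp_assoc)
  qed
  from this[OF h(1)] this[OF h(2)] show ?thesis by (simp add: eq)
qed

lemma full_subcategory_HomG: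
  "\<lbrakk>is_full_subcategory C S; X \<in> SOb S; Y \<in> SOb S\<rbrakk> \<Longrightarrow> HomG (induced_category C S) X Y = HomG C X Y"
  by (simp add: induced_category_def is_full_subcategory_def)

lemma full_subcategory_preadditive:
  assumes "is_full_subcategory C S"
  shows "preadditive_category (induced_category C S)"
proof -
  have [simp]: "Ob (induced_category C S) = SOb S" "Idt (induced_category C S) = Idt C"
    "Cmp (induced_category C S) = Cmp C"
    by (simp_all add: induced_category_def)
  have "X \<in> Ob C" if "X \<in> SOb S" for X
    using subsetD[OF _ that] assms unfolding is_full_subcategory_def is_subcategory_def by blast
  then show ?thesis
    by (intro preadditive_category.intro)
      (simp_all add: full_subcategory_HomG[OF assms] hom_group idt_closed cmp_closed idt_left idt_right
        cmp_assoc cmp_add_left cmp_add_right)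
qed

text \<open>The objects of the essential image, in a form that is manifestly a property of the
  module and not of a chosen isomorphism to some \<open>Mbar_obj e C X\<close>.\<close>

definition presentable :: "('o, 'm, 'u) modl \<Rightarrow> bool" where
  "presentable W \<longleftrightarrow> W \<in> Ob (Mod_cat C) \<and> (\<exists>X \<in> cospans C. \<exists>w. presents X W w)"

lemma presentableE:
  assumes "presentable W"
  obtains X w where "W \<in> Ob (Mod_cat C)" "X \<in> cospans C" "presents X W w" "generates W (Src X) w"
    "w \<in> carrier (FOb W (Src X))"
    "\<forall>T \<in> Ob C. \<forall>\<sigma> \<in> Hom C T (Src X). FMor W (Src X) T \<sigma> w = \<one>\<^bsub>FOb W T\<^esub> \<longleftrightarrow> (T, \<sigma>) \<in> Syz C X"
  using assms unfolding presentable_def presents_def generates_def by blast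

text \<open>An isomorphism carries the generator to a generator with the same annihilator, so the
  same cospan presents \<open>V\<close>.\<close>

lemma presentable_iso:
  assumes "presentable W" "V \<in> Ob (Mod_cat C)" "is_iso (Mod_cat C) W V \<eta>"
  shows "presentable V"
proof -
  obtain X w where W: "W \<in> Ob (Mod_cat C)" and X: "X \<in> cospans C" and gen: "generates W (Src X) w"
    and w: "w \<in> carrier (FOb W (Src X))"
    and ann [rule_format]: "\<forall>T \<in> Ob C. \<forall>\<sigma> \<in> Hom C T (Src X).
      FMor W (Src X) T \<sigma> w = \<one>\<^bsub>FOb W T\<^esub> \<longleftrightarrow> (T, \<sigma>) \<in> Syz C X"
    using assms(1) by (rule presentableE)
  note A = cospanD(1)[OF X]
  obtain \<theta> where \<eta>: "\<eta> \<in> Hom (Mod_cat C) W V" and \<theta>: "\<theta> \<in> Hom (Mod_cat C) V W"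
    and 1 [rule_format]: "\<forall>T \<in> Ob C. \<forall>x \<in> carrier (FOb W T). \<theta> T (\<eta> T x) = x"
    and 2 [rule_format]: "\<forall>T \<in> Ob C. \<forall>y \<in> carrier (FOb V T). \<eta> T (\<theta> T y) = y"
    using assms(3) by (rule iso_inverseD)
  have act: "FMor V (Src X) T \<sigma> (\<eta> (Src X) w) = \<eta> T (FMor W (Src X) T \<sigma> w)"
    if "T \<in> Ob C" "\<sigma> \<in> Hom C T (Src X)" for T \<sigma>
    using nat_act[OF \<eta> A that w] by simp
  have "generates V (Src X) (\<eta> (Src X) w)"
    unfolding generates_def
  proof (intro conjI ballI)
    fix T x assume T: "T \<in> Ob C" and x: "x \<in> carrier (FOb V T)"
    then obtain \<sigma> where \<sigma>: "\<sigma> \<in> Hom C T (Src X)" "\<theta> T x = FMor W (Src X) T \<sigma> w"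
      using gen nat_closed[OF \<theta> T x] unfolding generates_def by blast
    then have "x = FMor V (Src X) T \<sigma> (\<eta> (Src X) w)" using 2[OF T x] act[OF T] by simp
    then show "\<exists>\<sigma>\<in>Hom C T (Src X). x = FMor V (Src X) T \<sigma> (\<eta> (Src X) w)" using \<sigma>(1) by blast
  qed (rule A, rule nat_closed[OF \<eta> A w])
  moreover have "FMor V (Src X) T \<sigma> (\<eta> (Src X) w) = \<one>\<^bsub>FOb V T\<^esub> \<longleftrightarrow> (T, \<sigma>) \<in> Syz C X"
    if T: "T \<in> Ob C" and \<sigma>: "\<sigma> \<in> Hom C T (Src X)" for T \<sigma>
  proof -
    have "FMor V (Src X) T \<sigma> (\<eta> (Src X) w) = \<one>\<^bsub>FOb V T\<^esub> \<longleftrightarrow> FMor W (Src X) T \<sigma> w = \<one>\<^bsub>FOb W T\<^esub>"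
      using 1[OF T act_closed[OF W A T \<sigma> w]] act[OF T \<sigma>]
        group_hom.hom_one[OF nat_group_hom[OF W assms(2) \<eta> T]]
        group_hom.hom_one[OF nat_group_hom[OF assms(2) W \<theta> T]] by metis
    then show ?thesis using ann[OF T \<sigma>] by simp
  qed
  ultimately have "presents X V (\<eta> (Src X) w)" by (simp add: presents_def)
  then show ?thesis using X assms(2) by (auto simp: presentable_def)
qed

lemma presents_ex_iso:
  assumes "W \<in> Ob (Mod_cat C)" "V \<in> Ob (Mod_cat C)" "presents X W w" "presents X V v"
  shows "\<exists>\<eta>. is_iso (Mod_cat C) W V \<eta>"
  using ex_iso_generated[OF assms(1,2)] assms(3,4) unfolding presents_def by metis

text \<open>The two elements agree exactly if the difference of \<open>\<sigma>\<close> and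
  \<open>\<tau>\<close> is a syzygy. Moving \<open>\<tau>\<close> to the right turns the condition
  into \<open>\<sigma> \<gamma> = \<omega> \<rho> + \<tau> \<gamma>\<close>, a form in which both
  summands can be absorbed by one morphism out of a biproduct.\<close>

lemma presents_eq_iff:
  assumes W: "W \<in> Ob (Mod_cat C)" and X: "X \<in> cospans C" and pres: "presents X W w"
    and T: "T \<in> Ob C" and \<sigma>: "\<sigma> \<in> Hom C T (Src X)" and \<tau>: "\<tau> \<in> Hom C T (Src X)"
  shows "FMor W (Src X) T \<sigma> w = FMor W (Src X) T \<tau> w \<longleftrightarrow>
    (\<exists>\<omega> \<in> Hom C T (Rel X). Cmp C T (Src X) (Mid X) \<sigma> (gam X)
      = Cmp C T (Rel X) (Mid X) \<omega> (rho X) \<otimes>\<^bsub>HomG C T (Mid X)\<^esub> Cmp C T (Src X) (Mid X) \<tau> (gam X))"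
proof -
  note D = cospanD[OF X]
  have w: "w \<in> carrier (FOb W (Src X))" using pres by (simp add: presents_def generates_def)
  interpret ev: group_hom "HomG C T (Src X)" "FOb W T" "\<lambda>\<sigma>. FMor W (Src X) T \<sigma> w"
    by (rule eval_group_hom[OF W D(1) T w])
  interpret \<gamma>: group_hom "HomG C T (Src X)" "HomG C T (Mid X)" "\<lambda>\<sigma>. Cmp C T (Src X) (Mid X) \<sigma> (gam X)"
    by (rule cmp_hom_left[OF T D(1,2,4)])
  let ?d = "\<sigma> \<otimes>\<^bsub>HomG C T (Src X)\<^esub> inv\<^bsub>HomG C T (Src X)\<^esub> \<tau>"
  have d: "?d \<in> Hom C T (Src X)" using \<sigma> \<tau> by simp
  have "FMor W (Src X) T \<sigma> w = FMor W (Src X) T \<tau> w \<longleftrightarrow> FMor W (Src X) T ?d w = \<one>\<^bsub>FOb W T\<^esub>"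
    using \<sigma> \<tau> ev.H.inv_solve_right'[OF ev.H.one_closed ev.hom_closed[OF \<sigma>] ev.hom_closed[OF \<tau>]]
    by auto
  also have "\<dots> \<longleftrightarrow> (T, ?d) \<in> Syz C X" using pres T d by (simp add: presents_def)
  also have "\<dots> \<longleftrightarrow> (\<exists>\<omega> \<in> Hom C T (Rel X). Cmp C T (Src X) (Mid X) ?d (gam X)
      = Cmp C T (Rel X) (Mid X) \<omega> (rho X))" using T d by (simp add: Syz_def)
  also have "\<dots> \<longleftrightarrow> (\<exists>\<omega> \<in> Hom C T (Rel X). Cmp C T (Src X) (Mid X) \<sigma> (gam X)
      = Cmp C T (Rel X) (Mid X) \<omega> (rho X) \<otimes>\<^bsub>HomG C T (Mid X)\<^esub> Cmp C T (Src X) (Mid X) \<tau> (gam X))"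
    using \<sigma> \<tau> \<gamma>.H.inv_solve_right'[OF cmp_closed[OF T D(3,2) _ D(5)] \<gamma>.hom_closed[OF \<sigma>]
        \<gamma>.hom_closed[OF \<tau>]] by (auto cong: bex_cong)
  finally show ?thesis .
qed

end

locale small_additive_category = additive_category C for C :: "('o, 'm) addcat" +
  fixes e :: "'m set \<Rightarrow> 'u"
  assumes inj_e: "inj e"
begin

lemma presentable_Mbar_obj: "X \<in> cospans C \<Longrightarrow> presentable (Mbar_obj e C X)"
  using Mbar_obj_Mod[OF _ inj_e] presents_Mbar_obj[OF _ inj_e] by (auto simp: presentable_def)

text \<open>Realizes a given syzygy test by a module. The later constructions know this module only
  through its generator and annihilator, not through its cosets.\<close>

lemma ex_presented:
  assumes "X \<in> cospans C"
  obtains W :: "('o, 'm, 'u) modl" and w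
    where "presentable W" "W \<in> Ob (Mod_cat C)" "generates W (Src X) w"
      "w \<in> carrier (FOb W (Src X))"
      "\<forall>T \<in> Ob C. \<forall>\<sigma> \<in> Hom C T (Src X). FMor W (Src X) T \<sigma> w = \<one>\<^bsub>FOb W T\<^esub> \<longleftrightarrow> (T, \<sigma>) \<in> Syz C X"
  using presentable_Mbar_obj[OF assms] presents_Mbar_obj[OF assms inj_e] that
  unfolding presentable_def presents_def generates_def by blast

lemma presentable_yoneda_obj: "A \<in> Ob C \<Longrightarrow> presentable (yoneda_obj e C A)"
  using yoneda_obj_Mod[OF inj_e] presents_yoneda_obj[OF inj_e]
  unfolding presentable_def by (force simp: cospans_def idt_closed zero_closed)

text \<open>The map is given by sending the identity of \<open>A\<close> to \<open>f\<close>; its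
  value at \<open>\<sigma>\<close> follows from naturality at \<open>\<sigma>\<close>.\<close>

lemma ex_yoneda_mor:
  assumes A: "A \<in> Ob C" and B: "B \<in> Ob C" and f: "f \<in> Hom C A B"
  obtains \<eta> where "\<eta> \<in> Hom (Mod_cat C) (yoneda_obj e C A) (yoneda_obj e C B)"
    "\<forall>T \<in> Ob C. \<forall>\<sigma> \<in> Hom C T A. \<eta> T (single e \<sigma>) = single e (Cmp C T A B \<sigma> f)"
proof -
  have s: "single e x = single e y \<longleftrightarrow> x = y" for x y
    using inj_e by (simp add: single_def inj_eq)
  have act: "FMor (yoneda_obj e C A) A T \<sigma> (single e (Idt C A)) = single e \<sigma>"
    if "T \<in> Ob C" "\<sigma> \<in> Hom C T A" for T \<sigma>
    using that A by (simp add: yoneda_obj_act[OF inj_e] idt_closed idt_right)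
  obtain \<eta> where \<eta>: "\<eta> \<in> Hom (Mod_cat C) (yoneda_obj e C A) (yoneda_obj e C B)"
    "\<eta> A (single e (Idt C A)) = single e f"
    using ex_hom_from_generated[OF yoneda_obj_Mod[OF inj_e A] yoneda_obj_Mod[OF inj_e B]
        generates_yoneda_obj[OF inj_e A], of "single e f"] A B f
    by (auto simp: act mem_yoneda_obj yoneda_obj_act[OF inj_e] yoneda_obj_one s cmp_zero_left)
  have "\<eta> T (single e \<sigma>) = single e (Cmp C T A B \<sigma> f)" if T: "T \<in> Ob C" and \<sigma>: "\<sigma> \<in> Hom C T A" for T \<sigma>
    using nat_act[OF \<eta>(1) A T \<sigma>, of "single e (Idt C A)"] act[OF T \<sigma>] \<eta>(2)
      yoneda_obj_act[OF inj_e A f] A by (simp add: mem_yoneda_obj idt_closed)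
  with \<eta>(1) show thesis using that by blast
qed

section \<open>Cokernels and images of presentable modules\<close>

text \<open>Since \<open>f w = \<alpha> v\<close>, the image of \<open>f\<close> at \<open>T\<close>
  consists of the elements \<open>(\<tau> \<alpha>) v\<close>. Thus \<open>\<sigma> v\<close> lies
  in it exactly if \<open>\<sigma> \<gamma> = \<omega> \<rho> + \<tau> \<alpha> \<gamma>\<close> for
  some \<open>\<omega>\<close> and \<open>\<tau>\<close>, which is the syzygy condition for the
  enlarged relation object. The exactness clause is recorded because the treatment of images relies
  on it.\<close>

lemma ex_cokernel:
  fixes W V :: "('o, 'm, 'u) modl"
  assumes W: "presentable W" and V: "presentable V" and f: "f \<in> Hom (Mod_cat C) W V"
  obtains K q where "presentable K" "is_cokernel (Mod_cat C) W V f K q"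
    "\<forall>T \<in> Ob C. \<forall>b \<in> carrier (FOb V T). q T b = \<one>\<^bsub>FOb K T\<^esub> \<longleftrightarrow> b \<in> f T ` carrier (FOb W T)"
proof -
  obtain X w where WO: "W \<in> Ob (Mod_cat C)" and X: "X \<in> cospans C" and gW: "generates W (Src X) w"
    and w: "w \<in> carrier (FOb W (Src X))"
    using W by (rule presentableE)
  obtain Y v where VO: "V \<in> Ob (Mod_cat C)" and Y: "Y \<in> cospans C" and pV: "presents Y V v"
    and gV: "generates V (Src Y) v" and v: "v \<in> carrier (FOb V (Src Y))"
    using V by (rule presentableE)
  note DX = cospanD[OF X] and DY = cospanD[OF Y]
  \<comment> \<open>The element \<open>f w\<close> of \<open>V\<close> at \<open>Src X\<close> is a
    multiple of the generator \<open>v\<close>; this is where the morphism of cospans comes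
    from.\<close>
  obtain \<alpha> where \<alpha>: "\<alpha> \<in> Hom C (Src X) (Src Y)" "f (Src X) w = FMor V (Src Y) (Src X) \<alpha> v"
    using gV nat_closed[OF f DX(1) w] DX(1) unfolding generates_def by blast
  obtain B i j p q where B: "is_biproduct C (Rel Y) (Src X) B i j p q"
    using has_biproducts[OF DY(3) DX(1)] by blast
  then have BO: "B \<in> Ob C" and p: "p \<in> Hom C B (Rel Y)" and q: "q \<in> Hom C B (Src X)"
    by (auto simp: is_biproduct_def)
  define \<beta> where "\<beta> = Cmp C (Src X) (Src Y) (Mid Y) \<alpha> (gam Y)"
  have \<beta>: "\<beta> \<in> Hom C (Src X) (Mid Y)" unfolding \<beta>_def by (rule cmp_closed[OF DX(1) DY(1,2) \<alpha>(1) DY(4)])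
  \<comment> \<open>The new \<open>rho\<close> has the components \<open>rho Y\<close> and
    \<open>\<beta>\<close> on the two summands of \<open>B\<close>, so that
    \<open>\<omega> (rho Z)\<close> runs through all sums of a relation of \<open>Y\<close> and a
    morphism \<open>\<tau> \<alpha> \<gamma>\<close>.\<close>
  define Z where "Z = \<lparr>Src = Src Y, Mid = Mid Y, Rel = B, gam = gam Y,
    rho = Cmp C B (Rel Y) (Mid Y) p (rho Y) \<otimes>\<^bsub>HomG C B (Mid Y)\<^esub> Cmp C B (Src X) (Mid Y) q \<beta>\<rparr>"
  have Z: "Z \<in> cospans C"
    unfolding cospans_def Z_def using DX DY BO p q \<beta> by (simp add: add_closed cmp_closed)
  have rho: "Cmp C T B (Mid Y) \<omega> (rho Z)
      = Cmp C T (Rel Y) (Mid Y) (Cmp C T B (Rel Y) \<omega> p) (rho Y)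
        \<otimes>\<^bsub>HomG C T (Mid Y)\<^esub> Cmp C T (Src Y) (Mid Y) (Cmp C T (Src X) (Src Y) (Cmp C T B (Src X) \<omega> q) \<alpha>) (gam Y)"
    if "T \<in> Ob C" "\<omega> \<in> Hom C T B" for T \<omega>
    unfolding Z_def \<beta>_def using that DX DY BO p q \<alpha>(1)
    by (simp add: cmp_add_right cmp_closed cmp_assoc)
  have fact: "FMor V (Src Y) T (Cmp C T (Src X) (Src Y) \<tau> \<alpha>) v = f T (FMor W (Src X) T \<tau> w)"
    if "T \<in> Ob C" "\<tau> \<in> Hom C T (Src X)" for T \<tau>
    using act_cmp[OF VO DY(1) DX(1) that(1) \<alpha>(1) that(2) v] nat_act[OF f DX(1) that w] \<alpha>(2) by simp
  have syz: "(T, \<sigma>) \<in> Syz C Z \<longleftrightarrow> FMor V (Src Y) T \<sigma> v \<in> f T ` carrier (FOb W T)"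
    if T: "T \<in> Ob C" and \<sigma>: "\<sigma> \<in> Hom C T (Src Y)" for T \<sigma>
  proof -
    let ?g = "\<lambda>\<sigma>. Cmp C T (Src Y) (Mid Y) \<sigma> (gam Y)" and ?r = "\<lambda>\<omega>. Cmp C T (Rel Y) (Mid Y) \<omega> (rho Y)"
      and ?a = "\<lambda>\<tau>. Cmp C T (Src X) (Src Y) \<tau> \<alpha>"
    have "(T, \<sigma>) \<in> Syz C Z \<longleftrightarrow> (\<exists>\<omega> \<in> Hom C T B. ?g \<sigma> = Cmp C T B (Mid Y) \<omega> (rho Z))"
      using T \<sigma> by (simp add: Syz_def Z_def)
    also have "\<dots> \<longleftrightarrow> (\<exists>\<omega> \<in> Hom C T B. ?g \<sigma> = ?r (Cmp C T B (Rel Y) \<omega> p)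
        \<otimes>\<^bsub>HomG C T (Mid Y)\<^esub> ?g (?a (Cmp C T B (Src X) \<omega> q)))"
      using rho[OF T] by (auto cong: bex_cong)
    \<comment> \<open>A morphism from \<open>T\<close> to \<open>B\<close> amounts to a pair of
      morphisms to \<open>Rel Y\<close> and \<open>Src X\<close>.\<close>
    also have "\<dots> \<longleftrightarrow> (\<exists>\<tau> \<in> Hom C T (Src X). \<exists>\<omega> \<in> Hom C T (Rel Y).
        ?g \<sigma> = ?r \<omega> \<otimes>\<^bsub>HomG C T (Mid Y)\<^esub> ?g (?a \<tau>))"
    proof
      assume "\<exists>\<tau> \<in> Hom C T (Src X). \<exists>\<omega> \<in> Hom C T (Rel Y). ?g \<sigma> = ?r \<omega> \<otimes>\<^bsub>HomG C T (Mid Y)\<^esub> ?g (?a \<tau>)"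
      then obtain \<tau> \<omega> where \<tau>\<omega>: "\<tau> \<in> Hom C T (Src X)" "\<omega> \<in> Hom C T (Rel Y)"
        "?g \<sigma> = ?r \<omega> \<otimes>\<^bsub>HomG C T (Mid Y)\<^esub> ?g (?a \<tau>)" by blast
      obtain h where "h \<in> Hom C T B" "Cmp C T B (Rel Y) h p = \<omega>" "Cmp C T B (Src X) h q = \<tau>"
        using biproduct_pair[OF B DY(3) DX(1) T \<tau>\<omega>(2,1)] by blast
      then show "\<exists>\<omega> \<in> Hom C T B. ?g \<sigma> = ?r (Cmp C T B (Rel Y) \<omega> p)
        \<otimes>\<^bsub>HomG C T (Mid Y)\<^esub> ?g (?a (Cmp C T B (Src X) \<omega> q))" using \<tau>\<omega>(3) by blast
    next
      assume "\<exists>\<omega> \<in> Hom C T B. ?g \<sigma> = ?r (Cmp C T B (Rel Y) \<omega> p)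
        \<otimes>\<^bsub>HomG C T (Mid Y)\<^esub> ?g (?a (Cmp C T B (Src X) \<omega> q))"
      then show "\<exists>\<tau> \<in> Hom C T (Src X). \<exists>\<omega> \<in> Hom C T (Rel Y). ?g \<sigma> = ?r \<omega> \<otimes>\<^bsub>HomG C T (Mid Y)\<^esub> ?g (?a \<tau>)"
        using cmp_closed[OF T BO DX(1) _ q] cmp_closed[OF T BO DY(3) _ p] by blast
    qed
    also have "\<dots> \<longleftrightarrow> (\<exists>\<tau> \<in> Hom C T (Src X). FMor V (Src Y) T \<sigma> v = FMor V (Src Y) T (?a \<tau>) v)"
      using presents_eq_iff[OF VO Y pV T \<sigma> cmp_closed[OF T DX(1) DY(1) _ \<alpha>(1)]] by (simp cong: bex_cong)
    also have "\<dots> \<longleftrightarrow> FMor V (Src Y) T \<sigma> v \<in> f T ` carrier (FOb W T)"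
      unfolding generates_carrier[OF WO gW T] using fact[OF T] by (auto simp: image_iff)
    finally show ?thesis .
  qed
  obtain K :: "('o, 'm, 'u) modl" and k where pK: "presentable K" and KO: "K \<in> Ob (Mod_cat C)"
    and gK: "generates K (Src Z) k" and k: "k \<in> carrier (FOb K (Src Z))"
    and ann [rule_format]: "\<forall>T \<in> Ob C. \<forall>\<sigma> \<in> Hom C T (Src Z).
      FMor K (Src Z) T \<sigma> k = \<one>\<^bsub>FOb K T\<^esub> \<longleftrightarrow> (T, \<sigma>) \<in> Syz C Z"
    using Z by (rule ex_presented)
  have SrcZ: "Src Z = Src Y" by (simp add: Z_def)
  note gK = gK[unfolded SrcZ] and k = k[unfolded SrcZ] and ann = ann[unfolded SrcZ]
  have one: "\<one>\<^bsub>FOb V T\<^esub> \<in> f T ` carrier (FOb W T)" if T: "T \<in> Ob C" for T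
  proof -
    interpret group_hom "FOb W T" "FOb V T" "f T" by (rule nat_group_hom[OF WO VO f T])
    show ?thesis using hom_one G.one_closed by (metis imageI)
  qed
  \<comment> \<open>If \<open>\<sigma> v\<close> is zero, it lies in the image of \<open>f\<close>,
    so \<open>\<sigma>\<close> is a syzygy of \<open>Z\<close> and annihilates
    \<open>k\<close>.\<close>
  obtain t where t: "t \<in> Hom (Mod_cat C) V K" "t (Src Y) v = k"
    using ex_hom_from_generated[OF VO KO gV k] ann syz one by metis
  have ex: "t T b = \<one>\<^bsub>FOb K T\<^esub> \<longleftrightarrow> b \<in> f T ` carrier (FOb W T)"
    if T: "T \<in> Ob C" and b: "b \<in> carrier (FOb V T)" for T b
  proof -
    obtain \<sigma> where \<sigma>: "\<sigma> \<in> Hom C T (Src Y)" "b = FMor V (Src Y) T \<sigma> v"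
      using b unfolding generates_carrier[OF VO gV T] by blast
    then show ?thesis using nat_act[OF t(1) DY(1) T \<sigma>(1) v] t(2) ann[OF T \<sigma>(1)] syz[OF T \<sigma>(1)] by simp
  qed
  have "is_cokernel (Mod_cat C) W V f K t"
    by (rule is_cokernelI[OF VO KO f t(1) gV _ ex]) (use gK t(2) in simp_all)
  with pK ex show thesis using that by blast
qed

text \<open>Any cokernel is isomorphic to the one constructed above, compatibly with the maps from
  \<open>V\<close>. Presentability and the description of the zeros of \<open>q\<close> pass along
  this isomorphism.\<close>

lemma cokernel_exact:
  fixes W V K :: "('o, 'm, 'u) modl"
  assumes W: "presentable W" and V: "presentable V" and f: "f \<in> Hom (Mod_cat C) W V"
    and K: "is_cokernel (Mod_cat C) W V f K q"
  shows "presentable K"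
    and "\<lbrakk>T \<in> Ob C; b \<in> carrier (FOb V T)\<rbrakk>
      \<Longrightarrow> q T b = \<one>\<^bsub>FOb K T\<^esub> \<longleftrightarrow> b \<in> f T ` carrier (FOb W T)"
proof -
  interpret M: preadditive_category "Mod_cat C :: (('o, 'm, 'u) modl, _) addcat" by (rule Mod_preadditive)
  have WO: "W \<in> Ob (Mod_cat C)" and VO: "V \<in> Ob (Mod_cat C)" using W V by (auto simp: presentable_def)
  have KO: "K \<in> Ob (Mod_cat C)" and q: "q \<in> Hom (Mod_cat C) V K" using K by (auto simp: is_cokernel_def)
  obtain L r where L: "presentable L" "is_cokernel (Mod_cat C) W V f L r"
    and ex [rule_format]: "\<forall>T \<in> Ob C. \<forall>b \<in> carrier (FOb V T).
      r T b = \<one>\<^bsub>FOb L T\<^esub> \<longleftrightarrow> b \<in> f T ` carrier (FOb W T)"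
    by (rule ex_cokernel[OF W V f])
  have LO: "L \<in> Ob (Mod_cat C)" using L by (simp add: presentable_def)
  have r: "r \<in> Hom (Mod_cat C) V L" using L by (simp add: is_cokernel_def)
  obtain s where s: "is_iso (Mod_cat C) L K s" "Cmp (Mod_cat C) V L K r s = q"
    using M.cokernel_unique[OF WO VO f L(2) K] by blast
  show "presentable K" by (rule presentable_iso[OF L(1) KO s(1)])
  obtain t where sH: "s \<in> Hom (Mod_cat C) L K" and tH: "t \<in> Hom (Mod_cat C) K L"
    and 1 [rule_format]: "\<forall>T \<in> Ob C. \<forall>x \<in> carrier (FOb L T). t T (s T x) = x"
    using s(1) by (rule iso_inverseD)
  assume T: "T \<in> Ob C" and b: "b \<in> carrier (FOb V T)"
  have "q T b = s T (r T b)" using Mod_Cmp_apply[OF T b, of L K r s] s(2) by simp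
  then have "q T b = \<one>\<^bsub>FOb K T\<^esub> \<longleftrightarrow> r T b = \<one>\<^bsub>FOb L T\<^esub>"
    using 1[OF T nat_closed[OF r T b]] group_hom.hom_one[OF nat_group_hom[OF LO KO sH T]]
      group_hom.hom_one[OF nat_group_hom[OF KO LO tH T]] by metis
  then show "q T b = \<one>\<^bsub>FOb K T\<^esub> \<longleftrightarrow> b \<in> f T ` carrier (FOb W T)" using ex[OF T b] by simp
qed

text \<open>The image is generated by \<open>f w = \<alpha> v\<close>, and \<open>\<sigma>\<close>
  annihilates this element exactly if \<open>\<sigma> \<alpha>\<close> is a syzygy of
  \<open>Y\<close>. Replacing \<open>gam Y\<close> by \<open>\<alpha> (gam Y)\<close> makes this the
  syzygy condition of a cospan starting at \<open>Src X\<close>.\<close>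

lemma presentable_image:
  fixes W V I :: "('o, 'm, 'u) modl"
  assumes W: "presentable W" and V: "presentable V" and f: "f \<in> Hom (Mod_cat C) W V"
    and "is_image (Mod_cat C) W V f I i"
  shows "presentable I"
proof -
  interpret M: preadditive_category "Mod_cat C :: (('o, 'm, 'u) modl, _) addcat" by (rule Mod_preadditive)
  obtain K q where K: "is_cokernel (Mod_cat C) W V f K q" and I: "is_kernel (Mod_cat C) V K q I i"
    using assms(4) by (auto simp: is_image_def)
  have KO: "K \<in> Ob (Mod_cat C)" and q: "q \<in> Hom (Mod_cat C) V K" using K by (auto simp: is_cokernel_def)
  have IO: "I \<in> Ob (Mod_cat C)" using I by (simp add: is_kernel_def)
  obtain X w where WO: "W \<in> Ob (Mod_cat C)" and X: "X \<in> cospans C" and gW: "generates W (Src X) w"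
    and w: "w \<in> carrier (FOb W (Src X))"
    using W by (rule presentableE)
  obtain Y v where VO: "V \<in> Ob (Mod_cat C)" and Y: "Y \<in> cospans C"
    and gV: "generates V (Src Y) v" and v: "v \<in> carrier (FOb V (Src Y))"
    and annV [rule_format]: "\<forall>T \<in> Ob C. \<forall>\<sigma> \<in> Hom C T (Src Y).
      FMor V (Src Y) T \<sigma> v = \<one>\<^bsub>FOb V T\<^esub> \<longleftrightarrow> (T, \<sigma>) \<in> Syz C Y"
    using V by (rule presentableE)
  note DX = cospanD[OF X] and DY = cospanD[OF Y]
  obtain \<alpha> where \<alpha>: "\<alpha> \<in> Hom C (Src X) (Src Y)" "f (Src X) w = FMor V (Src Y) (Src X) \<alpha> v"
    using gV nat_closed[OF f DX(1) w] DX(1) unfolding generates_def by blast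
  define Z where "Z = \<lparr>Src = Src X, Mid = Mid Y, Rel = Rel Y,
    gam = Cmp C (Src X) (Src Y) (Mid Y) \<alpha> (gam Y), rho = rho Y\<rparr>"
  have Z: "Z \<in> cospans C"
    unfolding cospans_def Z_def using DX DY \<alpha>(1) by (simp add: cmp_closed)
  obtain L :: "('o, 'm, 'u) modl" and l where pL: "presentable L" and LO: "L \<in> Ob (Mod_cat C)"
    and gL: "generates L (Src Z) l"
    and annL [rule_format]: "\<forall>T \<in> Ob C. \<forall>\<sigma> \<in> Hom C T (Src Z).
      FMor L (Src Z) T \<sigma> l = \<one>\<^bsub>FOb L T\<^esub> \<longleftrightarrow> (T, \<sigma>) \<in> Syz C Z"
    using Z by (rule ex_presented)
  have SrcZ: "Src Z = Src X" by (simp add: Z_def)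
  note gL = gL[unfolded SrcZ] and annL = annL[unfolded SrcZ]
  have "FMor L (Src X) T \<sigma> l = \<one>\<^bsub>FOb L T\<^esub> \<longleftrightarrow> f T (FMor W (Src X) T \<sigma> w) = \<one>\<^bsub>FOb V T\<^esub>"
    if T: "T \<in> Ob C" and \<sigma>: "\<sigma> \<in> Hom C T (Src X)" for T \<sigma>
  proof -
    note c = cmp_closed[OF T DX(1) DY(1) \<sigma> \<alpha>(1)]
    have "FMor L (Src X) T \<sigma> l = \<one>\<^bsub>FOb L T\<^esub> \<longleftrightarrow> (T, Cmp C T (Src X) (Src Y) \<sigma> \<alpha>) \<in> Syz C Y"
      using annL[OF T \<sigma>] T \<sigma> c DX DY \<alpha>(1) by (simp add: Syz_def Z_def cmp_assoc)
    also have "\<dots> \<longleftrightarrow> FMor V (Src Y) T (Cmp C T (Src X) (Src Y) \<sigma> \<alpha>) v = \<one>\<^bsub>FOb V T\<^esub>"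
      using annV[OF T c] by simp
    also have "FMor V (Src Y) T (Cmp C T (Src X) (Src Y) \<sigma> \<alpha>) v = f T (FMor W (Src X) T \<sigma> w)"
      using act_cmp[OF VO DY(1) DX(1) T \<alpha>(1) \<sigma> v] nat_act[OF f DX(1) T \<sigma> w] \<alpha>(2) by simp
    finally show ?thesis .
  qed
  \<comment> \<open>The presented module \<open>L\<close> becomes a kernel of the very
    \<open>q\<close> of which \<open>I\<close> is a kernel, so both are isomorphic.\<close>
  from is_imageI[OF WO VO LO f gW gL this K cokernel_exact(2)[OF W V f K]]
  obtain j where "is_kernel (Mod_cat C) V K q L j" by blast
  then obtain s where "is_iso (Mod_cat C) L I s"
    using M.kernel_unique[OF VO KO q _ I] by blast
  then show ?thesis by (rule presentable_iso[OF pL IO])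
qed

section \<open>Biproducts and the zero object among presentable modules\<close>

text \<open>The maps \<open>g\<close> and \<open>r\<close> are the diagonal ones, and an equation
  between morphisms into \<open>B\<close> splits into its two projections. The biproduct
  \<open>A\<close> of the sources is prescribed, because its injections and projections are to
  induce the structure maps between the presented modules.\<close>

lemma ex_direct_sum_cospan:
  assumes X: "X \<in> cospans C" and Y: "Y \<in> cospans C" and A: "is_biproduct C (Src X) (Src Y) A i j p q"
  obtains Z where "Z \<in> cospans C" "Src Z = A"
    "\<forall>T \<in> Ob C. \<forall>\<sigma> \<in> Hom C T A. (T, \<sigma>) \<in> Syz C Z \<longleftrightarrow>
      (T, Cmp C T A (Src X) \<sigma> p) \<in> Syz C X \<and> (T, Cmp C T A (Src Y) \<sigma> q) \<in> Syz C Y"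
proof -
  note DX = cospanD[OF X] and DY = cospanD[OF Y]
  have AO: "A \<in> Ob C" and p: "p \<in> Hom C A (Src X)" and q: "q \<in> Hom C A (Src Y)"
    using A by (auto simp: is_biproduct_def)
  obtain B i' j' p' q' where B: "is_biproduct C (Mid X) (Mid Y) B i' j' p' q'"
    using has_biproducts[OF DX(2) DY(2)] by blast
  then have BO: "B \<in> Ob C" and p': "p' \<in> Hom C B (Mid X)" and q': "q' \<in> Hom C B (Mid Y)"
    by (auto simp: is_biproduct_def)
  obtain R i'' j'' p'' q'' where R: "is_biproduct C (Rel X) (Rel Y) R i'' j'' p'' q''"
    using has_biproducts[OF DX(3) DY(3)] by blast
  then have RO: "R \<in> Ob C" and p'': "p'' \<in> Hom C R (Rel X)" and q'': "q'' \<in> Hom C R (Rel Y)"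
    by (auto simp: is_biproduct_def)
  obtain g where g: "g \<in> Hom C A B" "Cmp C A B (Mid X) g p' = Cmp C A (Src X) (Mid X) p (gam X)"
    "Cmp C A B (Mid Y) g q' = Cmp C A (Src Y) (Mid Y) q (gam Y)"
    using biproduct_pair[OF B DX(2) DY(2) AO cmp_closed[OF AO DX(1,2) p DX(4)]
        cmp_closed[OF AO DY(1,2) q DY(4)]] by blast
  obtain r where r: "r \<in> Hom C R B" "Cmp C R B (Mid X) r p' = Cmp C R (Rel X) (Mid X) p'' (rho X)"
    "Cmp C R B (Mid Y) r q' = Cmp C R (Rel Y) (Mid Y) q'' (rho Y)"
    using biproduct_pair[OF B DX(2) DY(2) RO cmp_closed[OF RO DX(3,2) p'' DX(5)]
        cmp_closed[OF RO DY(3,2) q'' DY(5)]] by blast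
  let ?Z = "\<lparr>Src = A, Mid = B, Rel = R, gam = g, rho = r\<rparr>"
  show thesis
  proof (rule that[of ?Z])
    show "?Z \<in> cospans C" using AO BO RO g r by (simp add: cospans_def)
    show "Src ?Z = A" by simp
    show "\<forall>T \<in> Ob C. \<forall>\<sigma> \<in> Hom C T A. (T, \<sigma>) \<in> Syz C ?Z \<longleftrightarrow>
      (T, Cmp C T A (Src X) \<sigma> p) \<in> Syz C X \<and> (T, Cmp C T A (Src Y) \<sigma> q) \<in> Syz C Y"
    proof (intro ballI)
      fix T \<sigma> assume T: "T \<in> Ob C" and \<sigma>: "\<sigma> \<in> Hom C T A"
      note \<sigma>p = cmp_closed[OF T AO DX(1) \<sigma> p] and \<sigma>q = cmp_closed[OF T AO DY(1) \<sigma> q]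
      have eq: "Cmp C T A B \<sigma> g = Cmp C T R B \<omega> r \<longleftrightarrow>
          Cmp C T (Src X) (Mid X) (Cmp C T A (Src X) \<sigma> p) (gam X)
            = Cmp C T (Rel X) (Mid X) (Cmp C T R (Rel X) \<omega> p'') (rho X) \<and>
          Cmp C T (Src Y) (Mid Y) (Cmp C T A (Src Y) \<sigma> q) (gam Y)
            = Cmp C T (Rel Y) (Mid Y) (Cmp C T R (Rel Y) \<omega> q'') (rho Y)"
        if \<omega>: "\<omega> \<in> Hom C T R" for \<omega>
      proof -
        have "Cmp C T A B \<sigma> g = Cmp C T R B \<omega> r \<longleftrightarrow>
          Cmp C T B (Mid X) (Cmp C T A B \<sigma> g) p' = Cmp C T B (Mid X) (Cmp C T R B \<omega> r) p' \<and>
          Cmp C T B (Mid Y) (Cmp C T A B \<sigma> g) q' = Cmp C T B (Mid Y) (Cmp C T R B \<omega> r) q'"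
          using biproduct_eqI[OF B DX(2) DY(2) T cmp_closed[OF T AO BO \<sigma> g(1)]
              cmp_closed[OF T RO BO \<omega> r(1)]] by auto
        then show ?thesis
          using cmp_assoc[OF T AO BO DX(2) \<sigma> g(1) p'] cmp_assoc[OF T AO BO DY(2) \<sigma> g(1) q']
            cmp_assoc[OF T RO BO DX(2) \<omega> r(1) p'] cmp_assoc[OF T RO BO DY(2) \<omega> r(1) q']
            cmp_assoc[OF T AO DX(1,2) \<sigma> p DX(4)] cmp_assoc[OF T AO DY(1,2) \<sigma> q DY(4)]
            cmp_assoc[OF T RO DX(3,2) \<omega> p'' DX(5)] cmp_assoc[OF T RO DY(3,2) \<omega> q'' DY(5)]
          by (simp add: g(2,3) r(2,3))
      qed
      show "(T, \<sigma>) \<in> Syz C ?Z \<longleftrightarrow>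
        (T, Cmp C T A (Src X) \<sigma> p) \<in> Syz C X \<and> (T, Cmp C T A (Src Y) \<sigma> q) \<in> Syz C Y"
      proof
        assume "(T, \<sigma>) \<in> Syz C ?Z"
        then obtain \<omega> where \<omega>: "\<omega> \<in> Hom C T R" "Cmp C T A B \<sigma> g = Cmp C T R B \<omega> r"
          by (auto simp: Syz_def)
        then show "(T, Cmp C T A (Src X) \<sigma> p) \<in> Syz C X \<and> (T, Cmp C T A (Src Y) \<sigma> q) \<in> Syz C Y"
          using eq[OF \<omega>(1)] T \<sigma>p \<sigma>q cmp_closed[OF T RO DX(3) \<omega>(1) p''] cmp_closed[OF T RO DY(3) \<omega>(1) q'']
          unfolding Syz_def by blast
      next
        assume "(T, Cmp C T A (Src X) \<sigma> p) \<in> Syz C X \<and> (T, Cmp C T A (Src Y) \<sigma> q) \<in> Syz C Y"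
        then obtain \<omega> \<omega>' where \<omega>: "\<omega> \<in> Hom C T (Rel X)" "\<omega>' \<in> Hom C T (Rel Y)"
          "Cmp C T (Src X) (Mid X) (Cmp C T A (Src X) \<sigma> p) (gam X) = Cmp C T (Rel X) (Mid X) \<omega> (rho X)"
          "Cmp C T (Src Y) (Mid Y) (Cmp C T A (Src Y) \<sigma> q) (gam Y) = Cmp C T (Rel Y) (Mid Y) \<omega>' (rho Y)"
          by (auto simp: Syz_def)
        \<comment> \<open>The witnesses for the two cospans are independent of each other; as
          components of one morphism into \<open>R\<close> they form a joint witness.\<close>
        obtain h where "h \<in> Hom C T R" "Cmp C T R (Rel X) h p'' = \<omega>" "Cmp C T R (Rel Y) h q'' = \<omega>'"
          using biproduct_pair[OF R DX(3) DY(3) T \<omega>(1,2)] by blast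
        then have "h \<in> Hom C T R" "Cmp C T A B \<sigma> g = Cmp C T R B h r" using eq[of h] \<omega>(3,4) by auto
        then show "(T, \<sigma>) \<in> Syz C ?Z" using T \<sigma> by (auto simp: Syz_def)
      qed
    qed
  qed
qed

text \<open>Zero is its own kind of witness. The fact accounts for the cross components of the
  biproduct maps, which are zero morphisms of the base category.\<close>

lemma zero_Syz:
  assumes "X \<in> cospans C" "T \<in> Ob C"
  shows "(T, ZeroM C T (Src X)) \<in> Syz C X"
proof -
  note D = cospanD[OF assms(1)]
  have "Cmp C T (Src X) (Mid X) (ZeroM C T (Src X)) (gam X)
      = Cmp C T (Rel X) (Mid X) (ZeroM C T (Rel X)) (rho X)"
    using D assms(2) by (simp add: cmp_zero_left)
  then show ?thesis using zero_closed[OF assms(2) D(1)] zero_closed[OF assms(2) D(3)] assms(2)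
    by (auto simp: Syz_def)
qed

text \<open>The maps \<open>I\<close>, \<open>J\<close>, \<open>P\<close>, \<open>Q\<close> send
  generators to \<open>i b\<close>, \<open>j b\<close>, \<open>p w\<close>, \<open>q v\<close>.
  Every biproduct equation needs checking on a generator only, where it becomes the corresponding
  equation for \<open>A\<close> acting on that generator.\<close>

lemma ex_presentable_biproduct:
  fixes W V :: "('o, 'm, 'u) modl"
  assumes W: "presentable W" and V: "presentable V"
  shows "\<exists>B I J P Q. presentable B \<and> is_biproduct (Mod_cat C) W V B I J P Q"
proof -
  interpret M: preadditive_category "Mod_cat C :: (('o, 'm, 'u) modl, _) addcat" by (rule Mod_preadditive)
  obtain X w where WO: "W \<in> Ob (Mod_cat C)" and X: "X \<in> cospans C" and gW: "generates W (Src X) w"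
    and w: "w \<in> carrier (FOb W (Src X))"
    and annW [rule_format]: "\<forall>T \<in> Ob C. \<forall>\<sigma> \<in> Hom C T (Src X).
      FMor W (Src X) T \<sigma> w = \<one>\<^bsub>FOb W T\<^esub> \<longleftrightarrow> (T, \<sigma>) \<in> Syz C X"
    using W by (rule presentableE)
  obtain Y v where VO: "V \<in> Ob (Mod_cat C)" and Y: "Y \<in> cospans C" and gV: "generates V (Src Y) v"
    and v: "v \<in> carrier (FOb V (Src Y))"
    and annV [rule_format]: "\<forall>T \<in> Ob C. \<forall>\<sigma> \<in> Hom C T (Src Y).
      FMor V (Src Y) T \<sigma> v = \<one>\<^bsub>FOb V T\<^esub> \<longleftrightarrow> (T, \<sigma>) \<in> Syz C Y"
    using V by (rule presentableE)
  note DX = cospanD[OF X] and DY = cospanD[OF Y]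
  obtain A i j p q where A: "is_biproduct C (Src X) (Src Y) A i j p q"
    using has_biproducts[OF DX(1) DY(1)] by blast
  then have AO: "A \<in> Ob C" and i: "i \<in> Hom C (Src X) A" and j: "j \<in> Hom C (Src Y) A"
    and p: "p \<in> Hom C A (Src X)" and q: "q \<in> Hom C A (Src Y)"
    and ip: "Cmp C (Src X) A (Src X) i p = Idt C (Src X)" and jq: "Cmp C (Src Y) A (Src Y) j q = Idt C (Src Y)"
    and iq: "Cmp C (Src X) A (Src Y) i q = ZeroM C (Src X) (Src Y)"
    and jp: "Cmp C (Src Y) A (Src X) j p = ZeroM C (Src Y) (Src X)"
    and pi_qj: "Cmp C A (Src X) A p i \<otimes>\<^bsub>HomG C A A\<^esub> Cmp C A (Src Y) A q j = Idt C A"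
    by (auto simp: is_biproduct_def)
  obtain Z where Z: "Z \<in> cospans C" "Src Z = A"
    and syz [rule_format]: "\<forall>T \<in> Ob C. \<forall>\<sigma> \<in> Hom C T A. (T, \<sigma>) \<in> Syz C Z \<longleftrightarrow>
      (T, Cmp C T A (Src X) \<sigma> p) \<in> Syz C X \<and> (T, Cmp C T A (Src Y) \<sigma> q) \<in> Syz C Y"
    using X Y A by (rule ex_direct_sum_cospan)
  obtain B :: "('o, 'm, 'u) modl" and b where pB: "presentable B" and BO: "B \<in> Ob (Mod_cat C)"
    and gB: "generates B (Src Z) b" and b: "b \<in> carrier (FOb B (Src Z))"
    and annB [rule_format]: "\<forall>T \<in> Ob C. \<forall>\<sigma> \<in> Hom C T (Src Z).
      FMor B (Src Z) T \<sigma> b = \<one>\<^bsub>FOb B T\<^esub> \<longleftrightarrow> (T, \<sigma>) \<in> Syz C Z"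
    using Z(1) by (rule ex_presented)
  note gB = gB[unfolded Z(2)] and b = b[unfolded Z(2)] and annB = annB[unfolded Z(2)]
  note actB = act_cmp[OF BO AO _ _ _ _ b, symmetric] and actW = act_cmp[OF WO DX(1) _ _ _ _ w, symmetric]
    and actV = act_cmp[OF VO DY(1) _ _ _ _ v, symmetric]
  have "\<exists>I \<in> Hom (Mod_cat C) W B. I (Src X) w = FMor B A (Src X) i b"
  proof (rule ex_hom_from_generated[OF WO BO gW act_closed[OF BO AO DX(1) i b]])
    fix T \<sigma> assume T: "T \<in> Ob C" and \<sigma>: "\<sigma> \<in> Hom C T (Src X)" and "FMor W (Src X) T \<sigma> w = \<one>\<^bsub>FOb W T\<^esub>"
    then have "(T, \<sigma>) \<in> Syz C X" using annW by simp
    \<comment> \<open>The morphism \<open>\<sigma> i\<close> has components \<open>\<sigma>\<close>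
      and zero. Both are syzygies, so \<open>\<sigma> i\<close> is a syzygy of
      \<open>Z\<close>.\<close>
    then show "FMor B (Src X) T \<sigma> (FMor B A (Src X) i b) = \<one>\<^bsub>FOb B T\<^esub>"
      using T \<sigma> DX(1) DY(1) AO i p q ip iq
      by (simp add: actB annB syz cmp_closed cmp_assoc idt_right cmp_zero_right zero_Syz[OF Y])
  qed
  then obtain I where I: "I \<in> Hom (Mod_cat C) W B" "I (Src X) w = FMor B A (Src X) i b" by blast
  have "\<exists>J \<in> Hom (Mod_cat C) V B. J (Src Y) v = FMor B A (Src Y) j b"
  proof (rule ex_hom_from_generated[OF VO BO gV act_closed[OF BO AO DY(1) j b]])
    fix T \<sigma> assume T: "T \<in> Ob C" and \<sigma>: "\<sigma> \<in> Hom C T (Src Y)" and "FMor V (Src Y) T \<sigma> v = \<one>\<^bsub>FOb V T\<^esub>"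
    then have "(T, \<sigma>) \<in> Syz C Y" using annV by simp
    then show "FMor B (Src Y) T \<sigma> (FMor B A (Src Y) j b) = \<one>\<^bsub>FOb B T\<^esub>"
      using T \<sigma> DX(1) DY(1) AO j p q jp jq
      by (simp add: actB annB syz cmp_closed cmp_assoc idt_right cmp_zero_right zero_Syz[OF X])
  qed
  then obtain J where J: "J \<in> Hom (Mod_cat C) V B" "J (Src Y) v = FMor B A (Src Y) j b" by blast
  have "\<exists>P \<in> Hom (Mod_cat C) B W. P A b = FMor W (Src X) A p w"
  proof (rule ex_hom_from_generated[OF BO WO gB act_closed[OF WO DX(1) AO p w]])
    fix T \<sigma> assume T: "T \<in> Ob C" and \<sigma>: "\<sigma> \<in> Hom C T A" and "FMor B A T \<sigma> b = \<one>\<^bsub>FOb B T\<^esub>"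
    then show "FMor W A T \<sigma> (FMor W (Src X) A p w) = \<one>\<^bsub>FOb W T\<^esub>"
      using AO DX(1) p by (simp add: actW annB annW syz cmp_closed)
  qed
  then obtain P where P: "P \<in> Hom (Mod_cat C) B W" "P A b = FMor W (Src X) A p w" by blast
  have "\<exists>Q \<in> Hom (Mod_cat C) B V. Q A b = FMor V (Src Y) A q v"
  proof (rule ex_hom_from_generated[OF BO VO gB act_closed[OF VO DY(1) AO q v]])
    fix T \<sigma> assume T: "T \<in> Ob C" and \<sigma>: "\<sigma> \<in> Hom C T A" and "FMor B A T \<sigma> b = \<one>\<^bsub>FOb B T\<^esub>"
    then show "FMor V A T \<sigma> (FMor V (Src Y) A q v) = \<one>\<^bsub>FOb V T\<^esub>"
      using AO DY(1) q by (simp add: actV annB annV syz cmp_closed)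
  qed
  then obtain Q where Q: "Q \<in> Hom (Mod_cat C) B V" "Q A b = FMor V (Src Y) A q v" by blast
  have zeroW: "FMor W (Src X) T (ZeroM C T (Src X)) w = \<one>\<^bsub>FOb W T\<^esub>" if "T \<in> Ob C" for T
    using annW[OF that zero_closed[OF that DX(1)]] zero_Syz[OF X that] by simp
  have zeroV: "FMor V (Src Y) T (ZeroM C T (Src Y)) v = \<one>\<^bsub>FOb V T\<^esub>" if "T \<in> Ob C" for T
    using annV[OF that zero_closed[OF that DY(1)]] zero_Syz[OF Y that] by simp
  have IP: "Cmp (Mod_cat C) W B W I P = Idt (Mod_cat C) W"
    by (rule hom_eq_on_generator[OF gW M.cmp_closed[OF WO BO WO I(1) P(1)] M.idt_closed[OF WO]])
      (simp add: Mod_Cmp_apply[OF DX(1) w] Mod_Idt I(2) nat_act[OF P(1) AO DX(1) i b] P(2)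
        actW[OF AO DX(1) p i] ip act_idt[OF WO DX(1) w] DX(1) w)
  have JQ: "Cmp (Mod_cat C) V B V J Q = Idt (Mod_cat C) V"
    by (rule hom_eq_on_generator[OF gV M.cmp_closed[OF VO BO VO J(1) Q(1)] M.idt_closed[OF VO]])
      (simp add: Mod_Cmp_apply[OF DY(1) v] Mod_Idt J(2) nat_act[OF Q(1) AO DY(1) j b] Q(2)
        actV[OF AO DY(1) q j] jq act_idt[OF VO DY(1) v] DY(1) v)
  have IQ: "Cmp (Mod_cat C) W B V I Q = ZeroM (Mod_cat C) W V"
    by (rule hom_eq_on_generator[OF gW M.cmp_closed[OF WO BO VO I(1) Q(1)] M.zero_closed[OF WO VO]])
      (simp add: Mod_Cmp_apply[OF DX(1) w] Mod_zero I(2) nat_act[OF Q(1) AO DX(1) i b] Q(2)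
        actV[OF AO DX(1) q i] iq zeroV DX(1) w)
  have JP: "Cmp (Mod_cat C) V B W J P = ZeroM (Mod_cat C) V W"
    by (rule hom_eq_on_generator[OF gV M.cmp_closed[OF VO BO WO J(1) P(1)] M.zero_closed[OF VO WO]])
      (simp add: Mod_Cmp_apply[OF DY(1) v] Mod_zero J(2) nat_act[OF P(1) AO DY(1) j b] P(2)
        actW[OF AO DY(1) p j] jp zeroW DY(1) v)
  note PI = M.cmp_closed[OF BO WO BO P(1) I(1)] and QJ = M.cmp_closed[OF BO VO BO Q(1) J(1)]
  have "Cmp (Mod_cat C) B W B P I \<otimes>\<^bsub>HomG (Mod_cat C) B B\<^esub> Cmp (Mod_cat C) B V B Q J = Idt (Mod_cat C) B"
  proof (rule hom_eq_on_generator[OF gB M.add_closed[OF BO BO PI QJ] M.idt_closed[OF BO]])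
    \<comment> \<open>Naturality of \<open>I\<close> at \<open>p\<close> gives
      \<open>I (p w) = p (I w) = p (i b)\<close>, which is \<open>(p i) b\<close>; together with the
      analogue for \<open>J\<close>, additivity of the action in the morphism leaves the identity
      acting on \<open>b\<close>.\<close>
    have "I A (P A b) = FMor B A A (Cmp C A (Src X) A p i) b"
      using nat_act[OF I(1) DX(1) AO p w] actB[OF DX(1) AO i p] by (simp add: P(2) I(2))
    moreover have "J A (Q A b) = FMor B A A (Cmp C A (Src Y) A q j) b"
      using nat_act[OF J(1) DY(1) AO q v] actB[OF DY(1) AO j q] by (simp add: Q(2) J(2))
    ultimately have "I A (P A b) \<otimes>\<^bsub>FOb B A\<^esub> J A (Q A b) = b"
      using act_add[OF BO AO AO cmp_closed[OF AO DX(1) AO p i] cmp_closed[OF AO DY(1) AO q j] b]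
        act_idt[OF BO AO b] by (simp add: pi_qj)
    then show "(Cmp (Mod_cat C) B W B P I \<otimes>\<^bsub>HomG (Mod_cat C) B B\<^esub> Cmp (Mod_cat C) B V B Q J) A b
        = Idt (Mod_cat C) B A b"
      using AO b by (simp add: Mod_add Mod_Cmp_apply Mod_Idt)
  qed
  then have "is_biproduct (Mod_cat C) W V B I J P Q"
    using BO I(1) J(1) P(1) Q(1) IP JQ IQ JP by (simp add: is_biproduct_def)
  with pB show ?thesis by blast
qed

text \<open>The functor represented by a zero object has trivial groups as values, so maps into it
  and out of it are zero.\<close>

lemma ex_presentable_zero:
  obtains Z :: "('o, 'm, 'u) modl" where "presentable Z" "is_zero_object (Mod_cat C) Z"
proof -
  interpret M: preadditive_category "Mod_cat C :: (('o, 'm, 'u) modl, _) addcat" by (rule Mod_preadditive)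
  obtain Z where Z: "is_zero_object C Z" using has_zero_object by blast
  then have ZO: "Z \<in> Ob C" by (simp add: is_zero_object_def)
  let ?Z = "yoneda_obj e C Z"
  note YO = yoneda_obj_Mod[OF inj_e ZO]
  have triv: "x = \<one>\<^bsub>FOb ?Z T\<^esub>" if T: "T \<in> Ob C" and x: "x \<in> carrier (FOb ?Z T)" for T x
  proof -
    obtain f where f: "f \<in> Hom C T Z" "x = single e f" using x by (auto simp: mem_yoneda_obj)
    then have "f = ZeroM C T Z" using Z T zero_closed[OF T ZO] unfolding is_zero_object_def by blast
    then show ?thesis using f by (simp add: yoneda_obj_one)
  qed
  have "is_zero_object (Mod_cat C) ?Z"
    unfolding is_zero_object_def
  proof (intro conjI ballI)
    fix X :: "('o, 'm, 'u) modl" assume X: "X \<in> Ob (Mod_cat C)"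
    show "\<exists>!f. f \<in> Hom (Mod_cat C) X ?Z"
    proof (rule ex1I[of _ "ZeroM (Mod_cat C) X ?Z"])
      fix f assume f: "f \<in> Hom (Mod_cat C) X ?Z"
      show "f = ZeroM (Mod_cat C) X ?Z"
        by (rule Mod_hom_eqI[OF f M.zero_closed[OF X YO]])
          (use triv nat_closed[OF f] in \<open>simp add: Mod_zero\<close>)
    qed (rule M.zero_closed[OF X YO])
    show "\<exists>!f. f \<in> Hom (Mod_cat C) ?Z X"
    proof (rule ex1I[of _ "ZeroM (Mod_cat C) ?Z X"])
      fix f assume f: "f \<in> Hom (Mod_cat C) ?Z X"
      show "f = ZeroM (Mod_cat C) ?Z X"
      proof (rule Mod_hom_eqI[OF f M.zero_closed[OF YO X]])
        fix T x assume T: "T \<in> Ob C" and x: "x \<in> carrier (FOb ?Z T)"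
        show "f T x = ZeroM (Mod_cat C) ?Z X T x"
          using triv[OF T x] x T group_hom.hom_one[OF nat_group_hom[OF YO X f T]]
          by (simp add: Mod_zero)
      qed
    qed (rule M.zero_closed[OF YO X])
  qed (rule YO)
  with presentable_yoneda_obj[OF ZO] show thesis by (rule that)
qed

end

section \<open>The essential image\<close>

context small_additive_category
begin

definition presentable_subcat :: "(('o, 'm, 'u) modl, 'o \<Rightarrow> 'u \<Rightarrow> 'u) subcat" where
  "presentable_subcat = \<lparr>SOb = {W. presentable W},
    SHom = (\<lambda>W V. if presentable W \<and> presentable V then Hom (Mod_cat C) W V else {})\<rparr>"

lemma presentable_subcat_simps:
  "SOb presentable_subcat = {W. presentable W}"
  "SHom presentable_subcat W V = (if presentable W \<and> presentable V then Hom (Mod_cat C) W V else {})"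
  by (simp_all add: presentable_subcat_def)

lemma presentable_subcat_full: "is_full_subcategory (Mod_cat C) presentable_subcat"
proof -
  interpret M: preadditive_category "Mod_cat C :: (('o, 'm, 'u) modl, _) addcat" by (rule Mod_preadditive)
  have O: "presentable W \<Longrightarrow> W \<in> Ob (Mod_cat C)" for W :: "('o, 'm, 'u) modl"
    by (simp add: presentable_def)
  show ?thesis
    unfolding is_full_subcategory_def is_subcategory_def presentable_subcat_simps
    by (auto split: if_splits intro: O M.idt_closed M.cmp_closed)
qed

lemma presentable_subcat_replete: "is_replete (Mod_cat C) presentable_subcat"
  unfolding is_replete_def presentable_subcat_simps
proof (intro ballI allI impI)
  fix W V :: "('o, 'm, 'u) modl" and \<eta>
  assume W: "W \<in> {W. presentable W}" and V: "V \<in> Ob (Mod_cat C)" and \<eta>: "is_iso (Mod_cat C) W V \<eta>"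
  have "presentable V" using presentable_iso[OF _ V \<eta>] W by simp
  moreover have "\<eta> \<in> Hom (Mod_cat C) W V" using \<eta> by (simp add: is_iso_def)
  ultimately show "V \<in> {W. presentable W} \<and>
      \<eta> \<in> (if presentable W \<and> presentable V then Hom (Mod_cat C) W V else {})"
    using W by simp
qed

text \<open>Since \<open>S\<close> is full, containing the objects entails containing the hom
  sets.\<close>

lemma presentable_subcat_least:
  assumes "is_full_subcategory (Mod_cat C) S" "\<And>W. presentable W \<Longrightarrow> W \<in> SOb S"
  shows "subcat_le presentable_subcat S"
  unfolding subcat_le_def presentable_subcat_simps
  using assms unfolding is_full_subcategory_def by auto

text \<open>A presentable module and the value of the functor at a cospan presenting it have
  generators with equal annihilators. They are isomorphic, and repleteness brings the former into
  every competitor.\<close>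

lemma essential_image_eq: "essential_image (Q_cat C) (Mod_cat C) (Mbar e C) = presentable_subcat"
  unfolding essential_image_def
proof (rule the_equality)
  let ?\<Phi> = "\<lambda>S :: (('o, 'm, 'u) modl, 'o \<Rightarrow> 'u \<Rightarrow> 'u) subcat. is_full_subcategory (Mod_cat C) S \<and>
    is_replete (Mod_cat C) S \<and> (\<forall>X \<in> Ob (Q_cat C). FOb (Mbar e C) X \<in> SOb S)"
  have Q: "Ob (Q_cat C) = cospans C" by (simp add: Q_cat_def quotient_category_def Aux_cat_def)
  have \<Phi>: "?\<Phi> presentable_subcat"
    using presentable_subcat_full presentable_subcat_replete presentable_Mbar_obj
    by (simp add: Q Mbar_def presentable_subcat_simps)
  have least: "subcat_le presentable_subcat S" if S: "?\<Phi> S" for S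
  proof (rule presentable_subcat_least)
    fix W :: "('o, 'm, 'u) modl" assume "presentable W"
    then obtain X w where W: "W \<in> Ob (Mod_cat C)" and X: "X \<in> cospans C" "presents X W w"
      by (auto simp: presentable_def)
    have "\<exists>\<eta>. is_iso (Mod_cat C) (Mbar_obj e C X) W \<eta>"
      by (rule presents_ex_iso[OF Mbar_obj_Mod[OF X(1) inj_e] W presents_Mbar_obj[OF X(1) inj_e] X(2)])
    moreover have "Mbar_obj e C X \<in> SOb S" using S X(1) by (simp add: Q Mbar_def)
    ultimately show "W \<in> SOb S" using S W unfolding is_replete_def by blast
  qed (use S in blast)
  show "is_smallest_subcat ?\<Phi> presentable_subcat"
    using \<Phi> least unfolding is_smallest_subcat_def by blast
  fix E assume "is_smallest_subcat ?\<Phi> E"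
  \<comment> \<open>The description by \<open>THE\<close> also demands uniqueness: two smallest
    subcategories contain each other, and as records with equal fields they are equal.\<close>
  then have "subcat_le E presentable_subcat" "subcat_le presentable_subcat E"
    using \<Phi> least unfolding is_smallest_subcat_def by blast+
  then have "SOb E = SOb presentable_subcat" "SHom E = SHom presentable_subcat"
    by (simp_all add: subcat_le_def fun_eq_iff set_eq_subset)
  then show "E = presentable_subcat" by simp
qed

text \<open>Zero objects and biproducts of modules were found among the presentable ones. In a full
  subcategory hom groups and composition are the same, so they keep their defining properties
  there.\<close>

lemma presentable_subcat_additive: "is_additive_subcategory (Mod_cat C) presentable_subcat"
proof -
  interpret M: preadditive_category "Mod_cat C :: (('o, 'm, 'u) modl, _) addcat" by (rule Mod_preadditive)
  let ?I = "induced_category (Mod_cat C) presentable_subcat"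
  have O: "W \<in> Ob (Mod_cat C)" if "presentable W" for W :: "('o, 'm, 'u) modl"
    using that by (simp add: presentable_def)
  have hom: "HomG ?I W V = HomG (Mod_cat C) W V" if "presentable W" "presentable V" for W V
    using M.full_subcategory_HomG[OF presentable_subcat_full] that by (simp add: presentable_subcat_simps)
  have ob: "Ob ?I = {W. presentable W}" and idt: "Idt ?I = Idt (Mod_cat C)"
    and cmp: "Cmp ?I = Cmp (Mod_cat C)"
    by (simp_all add: induced_category_def presentable_subcat_simps)
  have "additive_category ?I"
  proof (intro additive_category.intro additive_category_axioms.intro)
    show "preadditive_category ?I"
      by (rule M.full_subcategory_preadditive[OF presentable_subcat_full])
    obtain Z :: "('o, 'm, 'u) modl" where Z: "presentable Z" "is_zero_object (Mod_cat C) Z"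
      by (rule ex_presentable_zero)
    then have "is_zero_object ?I Z"
      using O by (simp add: is_zero_object_def ob hom)
    then show "\<exists>Z. is_zero_object ?I Z" ..
  next
    fix W V assume "W \<in> Ob ?I" "V \<in> Ob ?I"
    then have WV: "presentable W" "presentable V" by (simp_all add: ob)
    then obtain B I J P Q where B: "presentable B" "is_biproduct (Mod_cat C) W V B I J P Q"
      using ex_presentable_biproduct by blast
    then have "is_biproduct ?I W V B I J P Q"
      using WV by (simp add: is_biproduct_def ob idt cmp hom)
    then show "\<exists>B I J P Q. is_biproduct ?I W V B I J P Q" by blast
  qed
  moreover have "subgroup (SHom presentable_subcat W V) (HomG (Mod_cat C) W V)"
    if "W \<in> SOb presentable_subcat" "V \<in> SOb presentable_subcat" for W V
    using group.subgroup_self[OF M.hom_grp[OF O O]] that by (simp add: presentable_subcat_simps)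
  ultimately show ?thesis
    using presentable_subcat_full by (simp add: is_additive_subcategory_def is_full_subcategory_def)
qed

lemma presentable_subcat_cokernels: "closed_under_cokernels (Mod_cat C) presentable_subcat"
  unfolding closed_under_cokernels_def presentable_subcat_simps
proof (intro ballI allI impI)
  fix W V K :: "('o, 'm, 'u) modl" and f q
  assume WV: "W \<in> {W. presentable W}" "V \<in> {W. presentable W}"
    and f: "f \<in> (if presentable W \<and> presentable V then Hom (Mod_cat C) W V else {})"
    and K: "is_cokernel (Mod_cat C) W V f K q"
  have "presentable K" using cokernel_exact(1)[OF _ _ _ K] f WV by simp
  moreover have "q \<in> Hom (Mod_cat C) V K" using K by (simp add: is_cokernel_def)
  ultimately show "K \<in> {W. presentable W} \<and>
      q \<in> (if presentable V \<and> presentable K then Hom (Mod_cat C) V K else {})"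
    using WV by simp
qed

lemma presentable_subcat_images: "closed_under_images (Mod_cat C) presentable_subcat"
  unfolding closed_under_images_def presentable_subcat_simps
proof (intro ballI allI impI)
  fix W V I :: "('o, 'm, 'u) modl" and f i
  assume WV: "W \<in> {W. presentable W}" "V \<in> {W. presentable W}"
    and f: "f \<in> (if presentable W \<and> presentable V then Hom (Mod_cat C) W V else {})"
    and im: "is_image (Mod_cat C) W V f I i"
  have "presentable I" using presentable_image[OF _ _ _ im] f WV by simp
  moreover have "i \<in> Hom (Mod_cat C) I V" using im by (auto simp: is_image_def is_kernel_def)
  ultimately show "I \<in> {W. presentable W} \<and>
      i \<in> (if presentable I \<and> presentable V then Hom (Mod_cat C) I V else {})"
    using WV by simp
qed

text \<open>Let \<open>K\<close> be a cokernel of \<open>(-, rho X)\<close>. The composite of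
  \<open>(-, gam X)\<close> with the projection to \<open>K\<close> sends \<open>\<sigma>\<close> to
  the class of \<open>\<sigma> \<gamma>\<close>, which is zero exactly if \<open>\<sigma>\<close> is
  a syzygy. Hence its image has a generator with the same annihilator as \<open>w\<close>. The
  criterion for images exhibits \<open>W\<close> itself, rather than an isomorphic copy, as an image
  object.\<close>

lemma presentable_in_closure:
  fixes W :: "('o, 'm, 'u) modl"
  assumes W: "presentable W" and full: "is_full_subcategory (Mod_cat C) S"
    and yon: "\<And>A. A \<in> Ob C \<Longrightarrow> yoneda_obj e C A \<in> SOb S"
    and coker: "closed_under_cokernels (Mod_cat C) S" and im: "closed_under_images (Mod_cat C) S"
  shows "W \<in> SOb S"
proof -
  interpret M: preadditive_category "Mod_cat C :: (('o, 'm, 'u) modl, _) addcat" by (rule Mod_preadditive)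
  have SHom: "SHom S F G = Hom (Mod_cat C) F G" if "F \<in> SOb S" "G \<in> SOb S" for F G
    using full that by (simp add: is_full_subcategory_def)
  obtain X w where WO: "W \<in> Ob (Mod_cat C)" and X: "X \<in> cospans C" and gW: "generates W (Src X) w"
    and ann [rule_format]: "\<forall>T \<in> Ob C. \<forall>\<sigma> \<in> Hom C T (Src X).
      FMor W (Src X) T \<sigma> w = \<one>\<^bsub>FOb W T\<^esub> \<longleftrightarrow> (T, \<sigma>) \<in> Syz C X"
    using W by (rule presentableE)
  note D = cospanD[OF X]
  let ?A = "yoneda_obj e C (Src X)" and ?\<Omega> = "yoneda_obj e C (Mid X)" and ?R = "yoneda_obj e C (Rel X)"
  note Ob = yoneda_obj_Mod[OF inj_e D(1)] yoneda_obj_Mod[OF inj_e D(2)]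
  note pres = presentable_yoneda_obj[OF D(1)] presentable_yoneda_obj[OF D(2)] presentable_yoneda_obj[OF D(3)]
  obtain \<rho> where \<rho>: "\<rho> \<in> Hom (Mod_cat C) ?R ?\<Omega>" and \<rho>_eq [rule_format]: "\<forall>T \<in> Ob C. \<forall>\<sigma> \<in> Hom C T (Rel X).
      \<rho> T (single e \<sigma>) = single e (Cmp C T (Rel X) (Mid X) \<sigma> (rho X))"
    by (rule ex_yoneda_mor[OF D(3,2,5)])
  obtain \<gamma> where \<gamma>: "\<gamma> \<in> Hom (Mod_cat C) ?A ?\<Omega>" and \<gamma>_eq [rule_format]: "\<forall>T \<in> Ob C. \<forall>\<sigma> \<in> Hom C T (Src X).
      \<gamma> T (single e \<sigma>) = single e (Cmp C T (Src X) (Mid X) \<sigma> (gam X))"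
    by (rule ex_yoneda_mor[OF D(1,2,4)])
  obtain K q where pK: "presentable K" and K: "is_cokernel (Mod_cat C) ?R ?\<Omega> \<rho> K q"
    and ex [rule_format]: "\<forall>T \<in> Ob C. \<forall>b \<in> carrier (FOb ?\<Omega> T).
      q T b = \<one>\<^bsub>FOb K T\<^esub> \<longleftrightarrow> b \<in> \<rho> T ` carrier (FOb ?R T)"
    by (rule ex_cokernel[OF pres(3,2) \<rho>])
  have KO: "K \<in> Ob (Mod_cat C)" and q: "q \<in> Hom (Mod_cat C) ?\<Omega> K" using K by (auto simp: is_cokernel_def)
  have KS: "K \<in> SOb S"
    using coker K \<rho> SHom[OF yon[OF D(3)] yon[OF D(2)]] yon[OF D(3)] yon[OF D(2)]
    unfolding closed_under_cokernels_def by blast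
  define g where "g = Cmp (Mod_cat C) ?A ?\<Omega> K \<gamma> q"
  have g: "g \<in> Hom (Mod_cat C) ?A K"
    unfolding g_def by (rule M.cmp_closed[OF Ob KO \<gamma> q])
  \<comment> \<open>An image is the kernel of a cokernel, so \<open>g\<close> needs a cokernel; one
    exists because \<open>K\<close> is presentable too.\<close>
  obtain L r where L: "is_cokernel (Mod_cat C) ?A K g L r"
    by (rule ex_cokernel[OF pres(1) pK g])
  have s: "single e x = single e y \<longleftrightarrow> x = y" for x y
    using inj_e by (simp add: single_def inj_eq)
  have "FMor W (Src X) T \<sigma> w = \<one>\<^bsub>FOb W T\<^esub>
      \<longleftrightarrow> g T (FMor ?A (Src X) T \<sigma> (single e (Idt C (Src X)))) = \<one>\<^bsub>FOb K T\<^esub>"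
    if T: "T \<in> Ob C" and \<sigma>: "\<sigma> \<in> Hom C T (Src X)" for T \<sigma>
  proof -
    let ?\<sigma>\<gamma> = "Cmp C T (Src X) (Mid X) \<sigma> (gam X)"
    have \<sigma>A: "single e \<sigma> \<in> carrier (FOb ?A T)" using \<sigma> by (simp add: mem_yoneda_obj)
    have \<sigma>\<Omega>: "single e ?\<sigma>\<gamma> \<in> carrier (FOb ?\<Omega> T)"
      using cmp_closed[OF T D(1,2) \<sigma> D(4)] by (simp add: mem_yoneda_obj)
    have "g T (FMor ?A (Src X) T \<sigma> (single e (Idt C (Src X)))) = g T (single e \<sigma>)"
      using yoneda_obj_act[OF inj_e D(1) idt_closed[OF D(1)]] idt_right[OF T D(1) \<sigma>] by simp
    also have "\<dots> = q T (single e ?\<sigma>\<gamma>)"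
      unfolding g_def using Mod_Cmp_apply[OF T \<sigma>A] \<gamma>_eq[OF T \<sigma>] by simp
    also have "q T (single e ?\<sigma>\<gamma>) = \<one>\<^bsub>FOb K T\<^esub> \<longleftrightarrow> single e ?\<sigma>\<gamma> \<in> \<rho> T ` carrier (FOb ?R T)"
      by (rule ex[OF T \<sigma>\<Omega>])
    also have "\<dots> \<longleftrightarrow> (\<exists>\<omega> \<in> Hom C T (Rel X). ?\<sigma>\<gamma> = Cmp C T (Rel X) (Mid X) \<omega> (rho X))"
    proof -
      have "carrier (FOb ?R T) = single e ` Hom C T (Rel X)" by (auto simp: mem_yoneda_obj)
      then show ?thesis by (auto simp: \<rho>_eq[OF T] s image_iff)
    qed
    also have "\<dots> \<longleftrightarrow> (T, \<sigma>) \<in> Syz C X" using T \<sigma> by (simp add: Syz_def)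
    finally show ?thesis using ann[OF T \<sigma>] by simp
  qed
  from is_imageI[OF Ob(1) KO WO g generates_yoneda_obj[OF inj_e D(1)] gW this L
      cokernel_exact(2)[OF pres(1) pK g L]]
  obtain j where "is_kernel (Mod_cat C) K L r W j" by blast
  then have "is_image (Mod_cat C) ?A K g W j" using L by (auto simp: is_image_def)
  then show ?thesis
    using im g SHom[OF yon[OF D(1)] KS] yon[OF D(1)] KS unfolding closed_under_images_def by blast
qed

end

theorem corollary3p9:
  fixes P :: "('o, 'm) addcat" and e :: "'m set \<Rightarrow> 'u"
  assumes "additive_category P" and "inj e"
  shows "is_smallest_subcat
    (\<lambda>F. is_full_subcategory (Mod_cat P) F \<and> is_replete (Mod_cat P) F \<and>
      is_additive_subcategory (Mod_cat P) F \<and>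
      (\<forall>A \<in> Ob P. yoneda_obj e P A \<in> SOb F) \<and>
      closed_under_cokernels (Mod_cat P) F \<and>
      closed_under_images (Mod_cat P) F)
    (essential_image (Q_cat P) (Mod_cat P) (Mbar e P))"
proof -
  interpret small_additive_category P e
    by (intro small_additive_category.intro small_additive_category_axioms.intro assms)
  show ?thesis
    unfolding is_smallest_subcat_def essential_image_eq
  proof (intro conjI allI impI)
    show "\<forall>A \<in> Ob P. yoneda_obj e P A \<in> SOb presentable_subcat"
      using presentable_yoneda_obj by (simp add: presentable_subcat_simps)
    fix S assume S: "is_full_subcategory (Mod_cat P) S \<and> is_replete (Mod_cat P) S \<and>
      is_additive_subcategory (Mod_cat P) S \<and> (\<forall>A \<in> Ob P. yoneda_obj e P A \<in> SOb S) \<and>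
      closed_under_cokernels (Mod_cat P) S \<and> closed_under_images (Mod_cat P) S"
    show "subcat_le presentable_subcat S"
      \<comment> \<open>By fullness it is enough that every presentable module is an object of
        \<open>S\<close>.\<close>
      by (rule presentable_subcat_least) (use S presentable_in_closure[of _ S] in auto)
  qed (rule presentable_subcat_full presentable_subcat_replete presentable_subcat_additive
      presentable_subcat_cokernels presentable_subcat_images)+
qed

end
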